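(* Let $G$ be simply connected of type $\mathbf{E}_7$. (1) The Tits section $\mathcal N_\circ$ is optimal, and $\mathcal N_\circ(s_i)^2\ne1$ for all $i$. Moreover, there is only one order profile of sections. (2) Two sections are $T$-conjugate if and only if they have the same value of $x$.
   Context: $F$ is an algebraically closed field, $G$ an almost-simple connected reductive group over $F$, $T$ a maximal torus, $N=N_G(T)$, $W=N/T$, $\pi:N\to W$ the projection. Let $\alpha_1,\dots,\alpha_7$ be the simple roots in Bourbaki numbering, $s_i$ the corresponding reflections, $\alpha_i^\vee$ the simple coroots. Fix a realization of the root system: isomorphisms $u_\alpha:\mathbf G_a\to U_\alpha$ onto the root subgroups with $tu_\alpha(x)t^{-1}=u_\alpha(\alpha(t)x)$, such that $\sigma_\alpha=u_\alpha(1)u_{-\alpha}(-1)u_\alpha(1)\in N$ maps to $s_\alpha$ and $u_\alpha(x)u_{-\alpha}(-x^{-1})u_\alpha(x)=\alpha^\vee(x)\sigma_\alpha$ for $x\in F^\times$; put $\sigma_i=\sigma_{\alpha_i}$. A section is a map $\mathcal S:W\to N$ with $\pi\circ\mathcal S=\mathrm{id}$ satisfying the braid relations (equivalently $\mathcal S$ is multiplicative along reduced expressions). It is determined by $\mathcal S(s_i)=t_i\sigma_i$, $t_i\in T$. The Tits section $\mathcal N_\circ$ is the one with all $t_i=1$. The order profile of $\mathcal S$ is the Dynkin diagram with the node of each $\alpha_i$ labeled by the order of $\mathcal S(s_i)$. For two sections write $\mathcal S'<\mathcal S$ if the order of $\mathcal S'(s_i)$ is greater than the order of $\mathcal S(s_i)$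 for all $i$; this translates to a partial order on order profiles, and a section is called optimal if it has the unique maximal order profile with respect to this partial order. Two sections $\mathcal S,\mathcal S'$ are $T$-conjugate if there is $t\in T$ with $t\mathcal S(w)t^{-1}=\mathcal S'(w)$ for all $w\in W$. Coordinates: $(x_1,\dots,x_7)$ denotes $\alpha_1^\vee(x_1)\cdots\alpha_7^\vee(x_7)\in T$. The sections are exactly those for which there is $x\in F^\times$ with $x^2=1$ such that for each $i$ the element $t_i$ is obtained from $(1,x,1,1,x,1,x)$ by replacing its $i$-th coordinate by an arbitrary element of $F^\times$.
   Formalization: The clause that the square of the Tits section at every s_i is not 1 is stated only when F has characteristic different from 2; in characteristic 2 that square is the i-th simple coroot at -1 = 1, which is 1, so the clause fails there. *)

theory Defs
  imports
    "HOL-Analysis.Analysis"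
    "HOL-Algebra.Group_Action"
    "HOL-Algebra.Multiplicative_Group"
    "HOL-Computational_Algebra.Polynomial"
    "HOL-Library.Extended_Nat"
begin

section \<open>Linear algebraic groups\<close>

text \<open>An affine algebraic group over an algebraically closed field is a group together with
  generators of its algebra of regular functions.  The field is the codomain of these functions.
  Closed subgroups of \<open>GL\<close> inherit the generators by restriction.\<close>

record ('g, 'f) alg_group = "'g monoid" +
  gens :: "('g \<Rightarrow> 'f) set"

inductive_set function_algebra :: "('g \<Rightarrow> 'f::field) set \<Rightarrow> ('g \<Rightarrow> 'f) set"
  for B :: "('g \<Rightarrow> 'f) set" where
  const: "(\<lambda>_. c) \<in> function_algebra B"
| gen: "p \<in> B \<Longrightarrow> p \<in> function_algebra B"
| add: "p \<in> function_algebra B \<Longrightarrow> q \<in> function_algebra B \<Longrightarrow> (\<lambda>g. p g + q g) \<in> function_algebra B"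
| mult: "p \<in> function_algebra B \<Longrightarrow> q \<in> function_algebra B \<Longrightarrow> (\<lambda>g. p g * q g) \<in> function_algebra B"

definition alg_hom :: "('g, 'f::field) alg_group \<Rightarrow> ('h, 'f) alg_group \<Rightarrow> ('g \<Rightarrow> 'h) set" where
  "alg_hom A B = {f \<in> hom A B.
     \<forall>y \<in> gens B. \<exists>p \<in> function_algebra (gens A). \<forall>g \<in> carrier A. y (f g) = p g}"

definition alg_iso :: "('g, 'f::field) alg_group \<Rightarrow> ('h, 'f) alg_group \<Rightarrow> ('g \<Rightarrow> 'h) set" where
  "alg_iso A B = {f \<in> alg_hom A B.
     bij_betw f (carrier A) (carrier B) \<and> inv_into (carrier A) f \<in> alg_hom B A}"

definition GL :: "('f::field ^ 'n ^ 'n, 'f) alg_group" where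
  "GL = \<lparr>carrier = {A. invertible A}, mult = (**), one = mat 1,
         gens = {\<lambda>A. A $ i $ j | i j. True} \<union> {\<lambda>A. inverse (det A)}\<rparr>"

abbreviation sub :: "('f::field ^ 'n ^ 'n) set \<Rightarrow> ('f ^ 'n ^ 'n, 'f) alg_group" where
  "sub H \<equiv> GL\<lparr>carrier := H\<rparr>"

definition Ga :: "('f::field, 'f) alg_group" where
  "Ga = \<lparr>carrier = UNIV, mult = (+), one = 0, gens = {\<lambda>x. x}\<rparr>"

definition Gm :: "('f::field, 'f) alg_group" where
  "Gm = \<lparr>carrier = - {0}, mult = (*), one = 1, gens = {\<lambda>x. x, inverse}\<rparr>"

definition Gm_power :: "nat \<Rightarrow> (nat \<Rightarrow> 'f::field, 'f) alg_group" where
  "Gm_power r = \<lparr>carrier = {..<r} \<rightarrow>\<^sub>E - {0},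
     mult = (\<lambda>x y. \<lambda>i\<in>{..<r}. x i * y i), one = (\<lambda>i\<in>{..<r}. 1),
     gens = {\<lambda>x. x i | i. i < r} \<union> {\<lambda>x. inverse (x i) | i. i < r}\<rparr>"

definition zariski_closed :: "('f::field ^ 'n ^ 'n) set \<Rightarrow> bool" where
  "zariski_closed Z \<longleftrightarrow>
     (\<exists>P \<subseteq> function_algebra (gens GL). Z = {A \<in> carrier GL. \<forall>p \<in> P. p A = 0})"

definition closed_subgroup :: "('f::field ^ 'n ^ 'n) set \<Rightarrow> bool" where
  "closed_subgroup H \<longleftrightarrow> subgroup H GL \<and> zariski_closed H"

definition zariski_connected :: "('f::field ^ 'n ^ 'n) set \<Rightarrow> bool" where
  "zariski_connected H \<longleftrightarrow>
     (\<forall>Y Z. zariski_closed Y \<and> zariski_closed Z \<and> Y \<union> Z = H \<and> Y \<inter> Z = {} \<longrightarrow> Y = {} \<or> Z = {})"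

definition unipotent :: "'f::field ^ 'n ^ 'n \<Rightarrow> bool" where
  "unipotent A \<longleftrightarrow> (\<exists>k. (((**) (A - mat 1)) ^^ k) (mat 1) = 0)"

definition connected_reductive :: "('f::field ^ 'n ^ 'n) set \<Rightarrow> bool" where
  "connected_reductive G \<longleftrightarrow> closed_subgroup G \<and> zariski_connected G \<and>
     (\<forall>U. closed_subgroup U \<and> zariski_connected U \<and> U \<lhd> sub G \<and> (\<forall>A \<in> U. unipotent A)
        \<longrightarrow> U = {mat 1})"

definition almost_simple :: "('f::field ^ 'n ^ 'n) set \<Rightarrow> bool" where
  "almost_simple G \<longleftrightarrow> \<not> comm_group (sub G) \<and>
     (\<forall>H. closed_subgroup H \<and> H \<lhd> sub G \<and> H \<noteq> G \<longrightarrow> finite H)"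

definition torus :: "('f::field ^ 'n ^ 'n) set \<Rightarrow> bool" where
  "torus T \<longleftrightarrow> closed_subgroup T \<and> (\<exists>r f. f \<in> alg_iso (Gm_power r) (sub T))"

definition maximal_torus :: "('f::field ^ 'n ^ 'n) set \<Rightarrow> ('f ^ 'n ^ 'n) set \<Rightarrow> bool" where
  "maximal_torus G T \<longleftrightarrow> torus T \<and> T \<subseteq> G \<and> (\<forall>T'. torus T' \<and> T \<subseteq> T' \<and> T' \<subseteq> G \<longrightarrow> T' = T)"


section \<open>Roots, coroots and realizations\<close>

text \<open>Characters are extensional on \<open>T\<close>, so that equality of functions is equality of
  characters.\<close>

definition characters :: "('f::field ^ 'n ^ 'n) set \<Rightarrow> ('f ^ 'n ^ 'n \<Rightarrow> 'f) set" where
  "characters T = alg_hom (sub T) Gm \<inter> extensional T"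

definition cocharacters :: "('f::field ^ 'n ^ 'n) set \<Rightarrow> ('f \<Rightarrow> 'f ^ 'n ^ 'n) set" where
  "cocharacters T = alg_hom Gm (sub T)"

definition neg_char ::
    "('f::field ^ 'n ^ 'n) set \<Rightarrow> ('f ^ 'n ^ 'n \<Rightarrow> 'f) \<Rightarrow> ('f ^ 'n ^ 'n \<Rightarrow> 'f)" where
  "neg_char T \<alpha> = (\<lambda>t\<in>T. inverse (\<alpha> t))"

definition root_isomorphism ::
    "('f::field ^ 'n ^ 'n) set \<Rightarrow> ('f ^ 'n ^ 'n) set \<Rightarrow> ('f ^ 'n ^ 'n \<Rightarrow> 'f)
       \<Rightarrow> ('f \<Rightarrow> 'f ^ 'n ^ 'n) \<Rightarrow> bool" where
  "root_isomorphism G T \<alpha> u \<longleftrightarrow> range u \<subseteq> G \<and> closed_subgroup (range u) \<and>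
     u \<in> alg_iso Ga (sub (range u)) \<and>
     (\<forall>t\<in>T. \<forall>x. t ** u x ** matrix_inv t = u (\<alpha> t * x))"

text \<open>For reductive \<open>G\<close>, a nontrivial character is a root exactly if it has a root subgroup.  That
  \<open>u\<close> is an isomorphism of varieties onto its image forces \<open>\<alpha>\<close> to occur in the Lie algebra and
  excludes Frobenius twists.\<close>

definition roots ::
    "('f::field ^ 'n ^ 'n) set \<Rightarrow> ('f ^ 'n ^ 'n) set \<Rightarrow> ('f ^ 'n ^ 'n \<Rightarrow> 'f) set" where
  "roots G T = {\<alpha> \<in> characters T. \<alpha> \<noteq> (\<lambda>t\<in>T. 1) \<and> (\<exists>u. root_isomorphism G T \<alpha> u)}"

text \<open>\<open>n\<close> acts on \<open>T\<close> as the reflection \<open>s\<^sub>\<alpha>\<close>, where \<open>c = \<alpha>\<^sup>\<or>\<close>.\<close>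

definition induces_reflection ::
    "('f::field ^ 'n ^ 'n) set \<Rightarrow> ('f ^ 'n ^ 'n \<Rightarrow> 'f) \<Rightarrow> ('f \<Rightarrow> 'f ^ 'n ^ 'n)
       \<Rightarrow> 'f ^ 'n ^ 'n \<Rightarrow> bool" where
  "induces_reflection T \<alpha> c n \<longleftrightarrow>
     (\<forall>t\<in>T. n ** t ** matrix_inv n = t ** matrix_inv (c (\<alpha> t)))"

definition is_coroot ::
    "('f::field ^ 'n ^ 'n) set \<Rightarrow> ('f ^ 'n ^ 'n) set \<Rightarrow> ('f ^ 'n ^ 'n \<Rightarrow> 'f)
       \<Rightarrow> ('f \<Rightarrow> 'f ^ 'n ^ 'n) \<Rightarrow> bool" where
  "is_coroot G T \<alpha> c \<longleftrightarrow> c \<in> cocharacters T \<and> (\<forall>x. x \<noteq> 0 \<longrightarrow> \<alpha> (c x) = x\<^sup>2) \<and>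
     (\<exists>n \<in> normalizer (sub G) T. induces_reflection T \<alpha> c n)"

definition tits_element ::
    "('f::field ^ 'n ^ 'n) set \<Rightarrow> (('f ^ 'n ^ 'n \<Rightarrow> 'f) \<Rightarrow> 'f \<Rightarrow> 'f ^ 'n ^ 'n)
       \<Rightarrow> ('f ^ 'n ^ 'n \<Rightarrow> 'f) \<Rightarrow> 'f ^ 'n ^ 'n" where
  "tits_element T u \<alpha> = u \<alpha> 1 ** u (neg_char T \<alpha>) (-1) ** u \<alpha> 1"

text \<open>\<open>cr \<alpha>\<close> is the coroot \<open>\<alpha>\<^sup>\<or>\<close> and \<open>u \<alpha>\<close> the isomorphism onto the root subgroup of \<open>\<alpha>\<close>.\<close>

definition realization ::
    "('f::field ^ 'n ^ 'n) set \<Rightarrow> ('f ^ 'n ^ 'n) set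
       \<Rightarrow> (('f ^ 'n ^ 'n \<Rightarrow> 'f) \<Rightarrow> 'f \<Rightarrow> 'f ^ 'n ^ 'n)
       \<Rightarrow> (('f ^ 'n ^ 'n \<Rightarrow> 'f) \<Rightarrow> 'f \<Rightarrow> 'f ^ 'n ^ 'n) \<Rightarrow> bool" where
  "realization G T cr u \<longleftrightarrow> (\<forall>\<alpha> \<in> roots G T.
     is_coroot G T \<alpha> (cr \<alpha>) \<and>
     root_isomorphism G T \<alpha> (u \<alpha>) \<and>
     tits_element T u \<alpha> \<in> normalizer (sub G) T \<and>
     induces_reflection T \<alpha> (cr \<alpha>) (tits_element T u \<alpha>) \<and>
     (\<forall>x. x \<noteq> 0 \<longrightarrow>
        u \<alpha> x ** u (neg_char T \<alpha>) (- inverse x) ** u \<alpha> x = cr \<alpha> x ** tits_element T u \<alpha>))"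


section \<open>Simply connected groups of type $E_7$\<close>

definition e7_adjacent :: "nat \<Rightarrow> nat \<Rightarrow> bool" where
  "e7_adjacent i j \<longleftrightarrow> {i, j} \<in> {{1, 3}, {3, 4}, {2, 4}, {4, 5}, {5, 6}, {6, 7}}"

definition e7_cartan :: "nat \<Rightarrow> nat \<Rightarrow> int" where
  "e7_cartan i j = (if i = j then 2 else if e7_adjacent i j then -1 else 0)"

text \<open>\<open>a 1, \<dots>, a 7\<close> are the simple roots in Bourbaki numbering.  Their linear independence follows
  from the invertibility of the Cartan matrix.\<close>

definition e7_base ::
    "('f::field ^ 'n ^ 'n) set \<Rightarrow> ('f ^ 'n ^ 'n) set
       \<Rightarrow> (('f ^ 'n ^ 'n \<Rightarrow> 'f) \<Rightarrow> 'f \<Rightarrow> 'f ^ 'n ^ 'n)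
       \<Rightarrow> (nat \<Rightarrow> 'f ^ 'n ^ 'n \<Rightarrow> 'f) \<Rightarrow> bool" where
  "e7_base G T cr a \<longleftrightarrow>
     (\<forall>i\<in>{1..7}. a i \<in> roots G T) \<and>
     (\<forall>\<beta> \<in> roots G T. \<exists>m :: nat \<Rightarrow> nat.
        \<beta> = (\<lambda>t\<in>T. \<Prod>i=1..7. a i t ^ m i) \<or> \<beta> = (\<lambda>t\<in>T. inverse (\<Prod>i=1..7. a i t ^ m i))) \<and>
     (\<forall>i\<in>{1..7}. \<forall>j\<in>{1..7}. \<forall>x. x \<noteq> 0 \<longrightarrow> a j (cr (a i) x) = x powi e7_cartan i j)"

definition torus_coords ::
    "(('f::field ^ 'n ^ 'n \<Rightarrow> 'f) \<Rightarrow> 'f \<Rightarrow> 'f ^ 'n ^ 'n) \<Rightarrow> (nat \<Rightarrow> 'f ^ 'n ^ 'n \<Rightarrow> 'f)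
       \<Rightarrow> (nat \<Rightarrow> 'f) \<Rightarrow> 'f ^ 'n ^ 'n" where
  "torus_coords cr a x = foldr (**) (map (\<lambda>i. cr (a i) (x i)) [1..<8]) (mat 1)"

text \<open>The cocharacter lattice is the coroot lattice.\<close>

definition simply_connected_e7 ::
    "('f::field ^ 'n ^ 'n) set \<Rightarrow> (('f ^ 'n ^ 'n \<Rightarrow> 'f) \<Rightarrow> 'f \<Rightarrow> 'f ^ 'n ^ 'n)
       \<Rightarrow> (nat \<Rightarrow> 'f ^ 'n ^ 'n \<Rightarrow> 'f) \<Rightarrow> bool" where
  "simply_connected_e7 T cr a \<longleftrightarrow> (\<forall>c \<in> cocharacters T. \<exists>m :: nat \<Rightarrow> int.
     \<forall>x. x \<noteq> 0 \<longrightarrow> c x = torus_coords cr a (\<lambda>i. x powi m i))"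

definition weyl_group ::
    "('f::field ^ 'n ^ 'n) set \<Rightarrow> ('f ^ 'n ^ 'n) set \<Rightarrow> ('f ^ 'n ^ 'n) set monoid" where
  "weyl_group G T = sub (normalizer (sub G) T) Mod T"

definition weyl_proj :: "('f::field ^ 'n ^ 'n) set \<Rightarrow> 'f ^ 'n ^ 'n \<Rightarrow> ('f ^ 'n ^ 'n) set" where
  "weyl_proj T n = T #>\<^bsub>GL\<^esub> n"

definition simple_reflection ::
    "('f::field ^ 'n ^ 'n) set \<Rightarrow> (('f ^ 'n ^ 'n \<Rightarrow> 'f) \<Rightarrow> 'f \<Rightarrow> 'f ^ 'n ^ 'n)
       \<Rightarrow> (nat \<Rightarrow> 'f ^ 'n ^ 'n \<Rightarrow> 'f) \<Rightarrow> nat \<Rightarrow> ('f ^ 'n ^ 'n) set" where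
  "simple_reflection T u a i = weyl_proj T (tits_element T u (a i))"

definition word_prod :: "('g, 'm) monoid_scheme \<Rightarrow> (nat \<Rightarrow> 'g) \<Rightarrow> nat list \<Rightarrow> 'g" where
  "word_prod M s is = foldr (\<lambda>i g. s i \<otimes>\<^bsub>M\<^esub> g) is \<one>\<^bsub>M\<^esub>"

text \<open>The standard identification of \<open>N/T\<close> with the Weyl group of the root system, a structure
  theorem for connected reductive groups: \<open>N/T\<close> acts faithfully on \<open>T\<close>, as \<open>T\<close> is its own
  centralizer, and is generated by the simple reflections.\<close>

definition weyl_group_of_roots ::
    "('f::field ^ 'n ^ 'n) set \<Rightarrow> ('f ^ 'n ^ 'n) set
       \<Rightarrow> (('f ^ 'n ^ 'n \<Rightarrow> 'f) \<Rightarrow> 'f \<Rightarrow> 'f ^ 'n ^ 'n)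
       \<Rightarrow> (nat \<Rightarrow> 'f ^ 'n ^ 'n \<Rightarrow> 'f) \<Rightarrow> bool" where
  "weyl_group_of_roots G T u a \<longleftrightarrow>
     {g \<in> G. \<forall>t\<in>T. g ** t = t ** g} = T \<and>
     (\<forall>w \<in> carrier (weyl_group G T).
        \<exists>is. set is \<subseteq> {1..7} \<and> w = word_prod (weyl_group G T) (simple_reflection T u a) is)"

definition simply_connected_E7_setting ::
    "('f::alg_closed_field ^ 'n ^ 'n) set \<Rightarrow> ('f ^ 'n ^ 'n) set
       \<Rightarrow> (('f ^ 'n ^ 'n \<Rightarrow> 'f) \<Rightarrow> 'f \<Rightarrow> 'f ^ 'n ^ 'n)
       \<Rightarrow> (('f ^ 'n ^ 'n \<Rightarrow> 'f) \<Rightarrow> 'f \<Rightarrow> 'f ^ 'n ^ 'n)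
       \<Rightarrow> (nat \<Rightarrow> 'f ^ 'n ^ 'n \<Rightarrow> 'f) \<Rightarrow> bool" where
  "simply_connected_E7_setting G T cr u a \<longleftrightarrow>
     connected_reductive G \<and> almost_simple G \<and> maximal_torus G T \<and>
     realization G T cr u \<and> e7_base G T cr a \<and> simply_connected_e7 T cr a \<and>
     weyl_group_of_roots G T u a"


section \<open>Sections of the Weyl group\<close>

definition reduced_word ::
    "('f::field ^ 'n ^ 'n) set \<Rightarrow> ('f ^ 'n ^ 'n) set
       \<Rightarrow> (('f ^ 'n ^ 'n \<Rightarrow> 'f) \<Rightarrow> 'f \<Rightarrow> 'f ^ 'n ^ 'n)
       \<Rightarrow> (nat \<Rightarrow> 'f ^ 'n ^ 'n \<Rightarrow> 'f) \<Rightarrow> nat list \<Rightarrow> bool" where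
  "reduced_word G T u a is \<longleftrightarrow> set is \<subseteq> {1..7} \<and>
     (\<forall>js. set js \<subseteq> {1..7} \<and>
        word_prod (weyl_group G T) (simple_reflection T u a) js =
        word_prod (weyl_group G T) (simple_reflection T u a) is \<longrightarrow> length is \<le> length js)"

definition is_section ::
    "('f::field ^ 'n ^ 'n) set \<Rightarrow> ('f ^ 'n ^ 'n) set
       \<Rightarrow> (('f ^ 'n ^ 'n \<Rightarrow> 'f) \<Rightarrow> 'f \<Rightarrow> 'f ^ 'n ^ 'n)
       \<Rightarrow> (nat \<Rightarrow> 'f ^ 'n ^ 'n \<Rightarrow> 'f) \<Rightarrow> (('f ^ 'n ^ 'n) set \<Rightarrow> 'f ^ 'n ^ 'n) \<Rightarrow> bool" where
  "is_section G T u a S \<longleftrightarrow>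
     (\<forall>w \<in> carrier (weyl_group G T). S w \<in> normalizer (sub G) T \<and> weyl_proj T (S w) = w) \<and>
     (\<forall>is. reduced_word G T u a is \<longrightarrow>
        S (word_prod (weyl_group G T) (simple_reflection T u a) is) =
        word_prod GL (\<lambda>i. S (simple_reflection T u a i)) is)"

definition is_tits_section ::
    "('f::field ^ 'n ^ 'n) set \<Rightarrow> ('f ^ 'n ^ 'n) set
       \<Rightarrow> (('f ^ 'n ^ 'n \<Rightarrow> 'f) \<Rightarrow> 'f \<Rightarrow> 'f ^ 'n ^ 'n)
       \<Rightarrow> (nat \<Rightarrow> 'f ^ 'n ^ 'n \<Rightarrow> 'f) \<Rightarrow> (('f ^ 'n ^ 'n) set \<Rightarrow> 'f ^ 'n ^ 'n) \<Rightarrow> bool" where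
  "is_tits_section G T u a S \<longleftrightarrow> is_section G T u a S \<and>
     (\<forall>i\<in>{1..7}. S (simple_reflection T u a i) = tits_element T u (a i))"

text \<open>\<^const>\<open>group.ord\<close> is \<open>0\<close> on elements of infinite order.\<close>

definition element_order :: "'f::field ^ 'n ^ 'n \<Rightarrow> enat" where
  "element_order g = (if group.ord GL g = 0 then \<infinity> else enat (group.ord GL g))"

definition order_profile ::
    "('f::field ^ 'n ^ 'n) set \<Rightarrow> (('f ^ 'n ^ 'n \<Rightarrow> 'f) \<Rightarrow> 'f \<Rightarrow> 'f ^ 'n ^ 'n)
       \<Rightarrow> (nat \<Rightarrow> 'f ^ 'n ^ 'n \<Rightarrow> 'f) \<Rightarrow> (('f ^ 'n ^ 'n) set \<Rightarrow> 'f ^ 'n ^ 'n)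
       \<Rightarrow> nat \<Rightarrow> enat" where
  "order_profile T u a S = (\<lambda>i\<in>{1..7}. element_order (S (simple_reflection T u a i)))"

text \<open>A larger order makes a profile smaller.\<close>

definition profile_less :: "(nat \<Rightarrow> enat) \<Rightarrow> (nat \<Rightarrow> enat) \<Rightarrow> bool" where
  "profile_less p q \<longleftrightarrow> (\<forall>i\<in>{1..7}. p i > q i)"

definition maximal_profile ::
    "('f::field ^ 'n ^ 'n) set \<Rightarrow> ('f ^ 'n ^ 'n) set
       \<Rightarrow> (('f ^ 'n ^ 'n \<Rightarrow> 'f) \<Rightarrow> 'f \<Rightarrow> 'f ^ 'n ^ 'n)
       \<Rightarrow> (nat \<Rightarrow> 'f ^ 'n ^ 'n \<Rightarrow> 'f) \<Rightarrow> (nat \<Rightarrow> enat) \<Rightarrow> bool" where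
  "maximal_profile G T u a p \<longleftrightarrow>
     (\<exists>S. is_section G T u a S \<and> p = order_profile T u a S) \<and>
     \<not> (\<exists>S. is_section G T u a S \<and> profile_less p (order_profile T u a S))"

definition optimal_section ::
    "('f::field ^ 'n ^ 'n) set \<Rightarrow> ('f ^ 'n ^ 'n) set
       \<Rightarrow> (('f ^ 'n ^ 'n \<Rightarrow> 'f) \<Rightarrow> 'f \<Rightarrow> 'f ^ 'n ^ 'n)
       \<Rightarrow> (nat \<Rightarrow> 'f ^ 'n ^ 'n \<Rightarrow> 'f) \<Rightarrow> (('f ^ 'n ^ 'n) set \<Rightarrow> 'f ^ 'n ^ 'n) \<Rightarrow> bool" where
  "optimal_section G T u a S \<longleftrightarrow> is_section G T u a S \<and>
     maximal_profile G T u a (order_profile T u a S) \<and>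
     (\<forall>p. maximal_profile G T u a p \<longrightarrow> p = order_profile T u a S)"

definition T_conjugate ::
    "('f::field ^ 'n ^ 'n) set \<Rightarrow> ('f ^ 'n ^ 'n) set
       \<Rightarrow> (('f ^ 'n ^ 'n) set \<Rightarrow> 'f ^ 'n ^ 'n) \<Rightarrow> (('f ^ 'n ^ 'n) set \<Rightarrow> 'f ^ 'n ^ 'n) \<Rightarrow> bool" where
  "T_conjugate G T S S' \<longleftrightarrow>
     (\<exists>t\<in>T. \<forall>w \<in> carrier (weyl_group G T). t ** S w ** matrix_inv t = S' w)"

text \<open>\<open>x\<close> is the parameter of \<open>S\<close>: the element \<open>t\<^sub>i\<close> is \<open>(1,x,1,1,x,1,x)\<close> with its \<open>i\<close>-th coordinate
  replaced by some \<open>y \<noteq> 0\<close>.\<close>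

definition section_parameter ::
    "('f::field ^ 'n ^ 'n) set \<Rightarrow> (('f ^ 'n ^ 'n \<Rightarrow> 'f) \<Rightarrow> 'f \<Rightarrow> 'f ^ 'n ^ 'n)
       \<Rightarrow> (('f ^ 'n ^ 'n \<Rightarrow> 'f) \<Rightarrow> 'f \<Rightarrow> 'f ^ 'n ^ 'n)
       \<Rightarrow> (nat \<Rightarrow> 'f ^ 'n ^ 'n \<Rightarrow> 'f) \<Rightarrow> (('f ^ 'n ^ 'n) set \<Rightarrow> 'f ^ 'n ^ 'n) \<Rightarrow> 'f \<Rightarrow> bool" where
  "section_parameter T cr u a S x \<longleftrightarrow> x\<^sup>2 = 1 \<and>
     (\<forall>i\<in>{1..7}. \<exists>y. y \<noteq> 0 \<and>
        S (simple_reflection T u a i) =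
        torus_coords cr a ((\<lambda>j. if j \<in> {2, 5, 7} then x else 1)(i := y)) ** tits_element T u (a i))"

end

theory Submission
  imports Defs "HOL-Algebra.Zassenhaus"
begin

text \<open>
  Simple connectedness means that the simple coroots identify \<open>(F\<^sup>\<times>)\<^sup>7\<close> with \<open>T\<close>
  (\<open>coords_surj\<close>, \<open>coords_inj\<close>).  Hence a section \<open>S\<close> is described by seven coordinate vectors, those
  of the elements \<open>t\<^sub>i\<close> with \<open>S(s\<^sub>i) = t\<^sub>i \<sigma>\<^sub>i\<close>, and conjugation by \<open>\<sigma>\<^sub>i\<close> acts on coordinates by an
  explicit reflection which only changes the \<open>i\<close>-th one.

  Both \<open>S\<close> and the Tits section satisfy the braid relations, so the torus factors on the two sides
  of such a relation for \<open>S\<close> coincide.  If \<open>i\<close> and \<open>j\<close> are not adjacent, this says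
  \<open>\<alpha>\<^sub>i(t\<^sub>j) = 1\<close>; if they are adjacent, it says that \<open>t\<^sub>i\<close> and \<open>t\<^sub>j\<close> agree in the coordinates other than
  \<open>i\<close> and \<open>j\<close>, together with one monomial equation.  Solving these equations on the diagram of type
  \<open>E\<^sub>7\<close> shows that outside its \<open>i\<close>-th coordinate, \<open>t\<^sub>i\<close> is \<open>(1,x,1,1,x,1,x)\<close> for a common \<open>x\<close> with
  \<open>x\<^sup>2 = 1\<close> (\<open>e7_section_equations\<close>, \<open>section_parameter_exists\<close>).

  Every node has an even number of neighbours among \<open>2, 5, 7\<close>.  Therefore \<open>t\<^sub>i s\<^sub>i(t\<^sub>i) = 1\<close> and
  \<open>S(s\<^sub>i)\<^sup>2 = \<sigma>\<^sub>i\<^sup>2 = \<alpha>\<^sub>i\<^sup>\<or>(-1)\<close> for every section (\<open>section_square\<close>).  Since \<open>S(s\<^sub>i)\<close> is not in \<open>T\<close>,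
  this square determines the order of \<open>S(s\<^sub>i)\<close>, so there is only one order profile, and the Tits
  section is optimal for that reason.  For a neighbour \<open>j\<close> of \<open>i\<close> one has
  \<open>\<alpha>\<^sub>j(\<alpha>\<^sub>i\<^sup>\<or>(-1)) = -1\<close>, so the square is nontrivial if \<open>2 \<noteq> 0\<close> in \<open>F\<close>.

  Conjugation by \<open>t \<in> T\<close> multiplies the \<open>i\<close>-th coordinate of \<open>t\<^sub>i\<close> by \<open>\<alpha>\<^sub>i(t)\<close> and leaves the others
  alone (\<open>conj_coords\<close>); in particular it preserves \<open>x\<close>.  Conversely, twice the inverse Cartan matrix
  is integral and \<open>F\<close> has square roots, so \<open>(\<alpha>\<^sub>1(t), \<dots>, \<alpha>\<^sub>7(t))\<close> takes every value in
  \<open>(F\<^sup>\<times>)\<^sup>7\<close> (\<open>root_value_surj\<close>), and two sections with the same \<open>x\<close> are conjugate.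

  Two points need care.  A section is defined through words of minimal length, so the words in the
  braid relations must be shown to be reduced and to represent the same element of \<open>W\<close>.  Both are
  read off from the action on coordinates, which is faithful because \<open>T\<close> is its own centralizer
  (\<open>words_equal_iff\<close>).  The formula for \<open>\<sigma>\<^sub>i\<^sup>2\<close> uses that the root subgroup of \<open>-\<alpha>\<^sub>i\<close> is also
  parametrized by a homomorphism, so \<open>-\<alpha>\<^sub>i\<close> must be recognized as a root (\<open>neg_root\<close>).\<close>

section \<open>The general linear group\<close>

lemma GL_simps [simp]:
  "carrier GL = {A. invertible A}" "A \<otimes>\<^bsub>GL\<^esub> B = A ** B" "\<one>\<^bsub>GL\<^esub> = mat 1"
  by (simp_all add: GL_def)

lemma gens_Gm [simp]: "gens Gm = {\<lambda>x. x, inverse}"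
  and carrier_Ga [simp]: "carrier Ga = UNIV"
  and carrier_Gm [simp]: "carrier Gm = - {0}"
  and mult_Ga [simp]: "x \<otimes>\<^bsub>Ga\<^esub> y = x + y"
  and mult_Gm [simp]: "x \<otimes>\<^bsub>Gm\<^esub> y = x * y"
  by (simp_all add: Ga_def Gm_def)

lemma matrix_inv_inverse:
  assumes "invertible A"
  shows "A ** matrix_inv A = mat 1" "matrix_inv A ** A = mat 1"
  using someI_ex[OF assms[unfolded invertible_def]] by (simp_all add: matrix_inv_def)

lemma invertible_matrix_inv: "invertible A \<Longrightarrow> invertible (matrix_inv A)"
  using matrix_inv_inverse[of A] by (auto simp: invertible_def)

lemma group_GL: "group (GL :: ('f::field ^ 'n ^ 'n, 'f) alg_group)"
proof (rule groupI)
  fix A :: "'f ^ 'n ^ 'n" assume "A \<in> carrier GL"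
  then show "\<exists>B \<in> carrier GL. B \<otimes>\<^bsub>GL\<^esub> A = \<one>\<^bsub>GL\<^esub>"
    using matrix_inv_inverse[of A] invertible_matrix_inv[of A] by auto
next
  show "\<one>\<^bsub>GL\<^esub> \<in> carrier (GL :: ('f ^ 'n ^ 'n, 'f) alg_group)"
    by (auto simp: invertible_def intro!: exI[of _ "mat 1"])
qed (auto simp: matrix_mul_assoc intro: invertible_mult)

lemma inv_GL: "invertible A \<Longrightarrow> inv\<^bsub>GL\<^esub> A = matrix_inv A"
  using group.inv_equality[OF group_GL, of "matrix_inv A" A] matrix_inv_inverse[of A]
    invertible_matrix_inv[of A] by simp

lemma matrix_inv_unique:
  fixes A B :: "'f::field ^ 'n ^ 'n"
  assumes "A ** B = mat 1"
  shows "matrix_inv A = B"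
proof -
  have "invertible A" using assms by (auto simp: invertible_right_inverse)
  then show ?thesis
    using assms by (metis matrix_inv_inverse(2) matrix_mul_assoc matrix_mul_lid matrix_mul_rid)
qed

lemma matrix_inv_inv:
  fixes A :: "'f::field ^ 'n ^ 'n"
  shows "invertible A \<Longrightarrow> matrix_inv (matrix_inv A) = A"
  by (simp add: matrix_inv_inverse matrix_inv_unique)

lemma matrix_cancel_right:
  fixes A B n :: "'f::field ^ 'n ^ 'n"
  assumes "invertible n" "A ** n = B ** n"
  shows "A = B"
proof -
  have "A ** (n ** matrix_inv n) = B ** (n ** matrix_inv n)"
    using assms(2) by (simp add: matrix_mul_assoc)
  then show ?thesis by (simp add: matrix_inv_inverse[OF assms(1)])
qed

section \<open>Regular functions and characters of the multiplicative group\<close>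

text \<open>Regularity along a map is only required on the relevant domain \<open>C\<close>, as morphisms of algebraic
  groups are only determined there.\<close>

lemma function_algebra_compose:
  assumes p: "p \<in> function_algebra B"
    and B: "\<And>y. y \<in> B \<Longrightarrow> \<exists>q \<in> function_algebra A. \<forall>g \<in> C. y (f g) = q g"
  shows "\<exists>q \<in> function_algebra A. \<forall>g \<in> C. p (f g) = q g"
  using p
proof induction
  case (const c)
  then show ?case by (intro bexI[OF _ function_algebra.const[of c]]) auto
next
  case (gen p)
  then show ?case by (rule B)
next
  case (add p q)
  then obtain p' q' where "p' \<in> function_algebra A" "q' \<in> function_algebra A"
    "\<forall>g\<in>C. p (f g) = p' g" "\<forall>g\<in>C. q (f g) = q' g" by blast
  then show ?case by (intro bexI[OF _ function_algebra.add[of p' _ q']]) auto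
next
  case (mult p q)
  then obtain p' q' where "p' \<in> function_algebra A" "q' \<in> function_algebra A"
    "\<forall>g\<in>C. p (f g) = p' g" "\<forall>g\<in>C. q (f g) = q' g" by blast
  then show ?case by (intro bexI[OF _ function_algebra.mult[of p' _ q']]) auto
qed

lemma alg_hom_regular:
  assumes "f \<in> alg_hom A B" and "p \<in> function_algebra (gens B)"
  shows "\<exists>q \<in> function_algebra (gens A). \<forall>g \<in> carrier A. p (f g) = q g"
  by (rule function_algebra_compose[OF assms(2)]) (use assms(1) in \<open>unfold alg_hom_def, blast\<close>)

lemma alg_homI:
  assumes "f \<in> hom A B"
    and "\<And>y. y \<in> gens B \<Longrightarrow>
      \<exists>q \<in> function_algebra (gens A). \<forall>g \<in> carrier A. y (f g) = q g"
  shows "f \<in> alg_hom A B"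
  using assms unfolding alg_hom_def by blast

lemma alg_hom_in_hom: "f \<in> alg_hom A B \<Longrightarrow> f \<in> hom A B"
  by (simp add: alg_hom_def)

lemma alg_hom_closed: "f \<in> alg_hom A B \<Longrightarrow> x \<in> carrier A \<Longrightarrow> f x \<in> carrier B"
  by (auto simp: alg_hom_def hom_def)

lemma alg_hom_mult:
  "f \<in> alg_hom A B \<Longrightarrow> x \<in> carrier A \<Longrightarrow> y \<in> carrier A \<Longrightarrow>
    f (x \<otimes>\<^bsub>A\<^esub> y) = f x \<otimes>\<^bsub>B\<^esub> f y"
  by (auto simp: alg_hom_def hom_def)

lemma alg_hom_compose:
  assumes f: "f \<in> alg_hom A B" and g: "g \<in> alg_hom B C"
  shows "(\<lambda>x. g (f x)) \<in> alg_hom A C"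
proof (rule alg_homI)
  show "(\<lambda>x. g (f x)) \<in> hom A C"
    using alg_hom_in_hom[OF f] alg_hom_in_hom[OF g] by (auto simp: hom_def Pi_def)
next
  fix y assume y: "y \<in> gens C"
  obtain p where p: "p \<in> function_algebra (gens B)" "\<forall>x \<in> carrier B. y (g x) = p x"
    using alg_hom_regular[OF g function_algebra.gen[OF y]] by blast
  obtain q where "q \<in> function_algebra (gens A)" "\<forall>x \<in> carrier A. p (f x) = q x"
    using alg_hom_regular[OF f p(1)] by blast
  then show "\<exists>q \<in> function_algebra (gens A). \<forall>x \<in> carrier A. y (g (f x)) = q x"
    using p(2) alg_hom_closed[OF f] by (intro bexI[of _ q]) auto
qed

lemma function_algebra_sum:
  "finite I \<Longrightarrow> (\<And>i. i \<in> I \<Longrightarrow> p i \<in> function_algebra B) \<Longrightarrow>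
    (\<lambda>g. \<Sum>i\<in>I. p i g) \<in> function_algebra B"
  by (induction rule: finite_induct) (auto intro: function_algebra.intros)

text \<open>If the field were finite, adding one to the product of all linear factors \<open>X - c\<close> would give a
  polynomial without roots.\<close>

lemma infinite_UNIV_alg_closed: "infinite (UNIV :: 'f::alg_closed_field set)"
proof
  assume fin: "finite (UNIV :: 'f set)"
  define p where "p = (\<Prod>c\<in>(UNIV :: 'f set). [:-c, 1:]) + 1"
  have "degree (\<Prod>c\<in>(UNIV :: 'f set). [:-c, 1:]) = (\<Sum>c\<in>(UNIV :: 'f set). 1)"
    by (subst degree_prod_eq_sum_degree) auto
  also have "\<dots> > 0" using fin by (simp add: card_gt_0_iff)
  finally have "degree p > 0" by (simp add: p_def degree_add_eq_left)
  then obtain x where "poly p x = 0" using alg_closed_imp_poly_has_root by blast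
  moreover have "poly (\<Prod>c\<in>(UNIV :: 'f set). [:-c, 1:]) x = 0"
    using fin by (auto simp: poly_prod)
  ultimately show False by (simp add: p_def)
qed

lemma poly_eq_on_units:
  fixes p q :: "'f::alg_closed_field poly"
  assumes "\<And>x. x \<noteq> 0 \<Longrightarrow> poly p x = poly q x"
  shows "p = q"
proof (rule ccontr)
  assume "p \<noteq> q"
  then have "finite {x. poly (p - q) x = 0}" by (intro poly_roots_finite) simp
  moreover have "UNIV - {0} \<subseteq> {x. poly (p - q) x = 0}" using assms by auto
  ultimately show False
    using infinite_UNIV_alg_closed by (metis finite_Diff2 finite.emptyI finite_insert finite_subset)
qed

lemma power_eq_imp_exponents_eq:
  assumes "\<And>x :: 'f::alg_closed_field. x \<noteq> 0 \<Longrightarrow> x ^ k = x ^ l"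
  shows "k = l"
proof -
  have "Polynomial.monom (1::'f) k = Polynomial.monom 1 l"
    by (rule poly_eq_on_units) (use assms in \<open>simp add: poly_monom\<close>)
  then show ?thesis by (metis degree_monom_eq one_neq_zero)
qed

text \<open>Integer exponents are reduced to natural ones by multiplying with a large power of the base.\<close>

lemma powi_eq_imp_exponents_eq:
  assumes *: "\<And>x :: 'f::alg_closed_field. x \<noteq> 0 \<Longrightarrow> x powi k = x powi l"
  shows "k = l"
proof -
  define N where "N = \<bar>k\<bar> + \<bar>l\<bar>"
  have "x ^ nat (k + N) = x ^ nat (l + N)" if "x \<noteq> 0" for x :: 'f
  proof -
    have "x powi (k + N) = x powi (l + N)" using *[OF that] that by (simp add: power_int_add)
    then show ?thesis by (simp add: power_int_def N_def split: if_splits)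
  qed
  then have "nat (k + N) = nat (l + N)" by (rule power_eq_imp_exponents_eq)
  then show ?thesis by (auto simp: N_def)
qed

lemma regular_on_Gm_is_Laurent:
  assumes "q \<in> function_algebra (gens Gm)"
  shows "\<exists>P k. \<forall>x::'f::field. x \<noteq> 0 \<longrightarrow> q x * x ^ k = poly P x"
  using assms
proof induction
  case (const c)
  then show ?case by (intro exI[of _ "[:c:]"] exI[of _ 0]) auto
next
  case (gen p)
  then consider "p = (\<lambda>x. x)" | "p = inverse" by auto
  then show ?case
  proof cases
    case 1
    then show ?thesis by (intro exI[of _ "[:0, 1:]"] exI[of _ 0]) auto
  next
    case 2
    then show ?thesis by (intro exI[of _ "1"] exI[of _ 1]) auto
  qed
next
  case (add p q)
  obtain P k where P: "\<And>x. x \<noteq> 0 \<Longrightarrow> p x * x ^ k = poly P x"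
    using add.IH(1) by auto
  obtain Q l where Q: "\<And>x. x \<noteq> 0 \<Longrightarrow> q x * x ^ l = poly Q x"
    using add.IH(2) by auto
  have "(p x + q x) * x ^ (k + l) = poly (P * Polynomial.monom 1 l + Q * Polynomial.monom 1 k) x" if "x \<noteq> 0" for x
  proof -
    have "(p x + q x) * x ^ (k + l) = (p x * x ^ k) * x ^ l + (q x * x ^ l) * x ^ k"
      by (simp add: power_add algebra_simps)
    then show ?thesis by (simp add: P[OF that] Q[OF that] poly_monom)
  qed
  then show ?case by blast
next
  case (mult p q)
  obtain P k where P: "\<And>x. x \<noteq> 0 \<Longrightarrow> p x * x ^ k = poly P x"
    using mult.IH(1) by auto
  obtain Q l where Q: "\<And>x. x \<noteq> 0 \<Longrightarrow> q x * x ^ l = poly Q x"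
    using mult.IH(2) by auto
  have "(p x * q x) * x ^ (k + l) = poly (P * Q) x" if "x \<noteq> 0" for x
  proof -
    have "(p x * q x) * x ^ (k + l) = (p x * x ^ k) * (q x * x ^ l)"
      by (simp add: power_add mult_ac)
    then show ?thesis by (simp add: P[OF that] Q[OF that])
  qed
  then show ?case by blast
qed

text \<open>Compare the leading coefficients in \<open>P(yX) = P(y)P(X)\<close>.\<close>

lemma multiplicative_polynomial_is_monomial:
  fixes P :: "'f::alg_closed_field poly"
  assumes "P \<noteq> 0" and mult: "\<And>x y. x \<noteq> 0 \<Longrightarrow> y \<noteq> 0 \<Longrightarrow> poly P (x * y) = poly P x * poly P y"
  shows "\<exists>k. \<forall>x. x \<noteq> 0 \<longrightarrow> poly P x = x ^ k"
proof (intro exI allI impI)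
  show "poly P y = y ^ degree P" if "y \<noteq> 0" for y
  proof -
    have "pcompose P [:0, y:] = Polynomial.smult (poly P y) P"
      by (rule poly_eq_on_units) (use that in \<open>simp add: poly_pcompose mult mult.commute\<close>)
    then have "Polynomial.coeff (pcompose P [:0, y:]) (degree P) = poly P y * lead_coeff P" by simp
    moreover have "Polynomial.coeff (pcompose P [:0, y:]) (degree P) = y ^ degree P * lead_coeff P"
      by (simp add: coeff_pcompose_linear)
    ultimately show ?thesis using assms(1) by simp
  qed
qed

text \<open>Clearing the denominator of a character leaves a multiplicative polynomial.\<close>

lemma Gm_character_is_power:
  fixes h :: "'f::alg_closed_field \<Rightarrow> 'f"
  assumes "h \<in> alg_hom Gm Gm"
  obtains n where "\<And>x. x \<noteq> 0 \<Longrightarrow> h x = x powi n"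
proof -
  have nz: "h x \<noteq> 0" if "x \<noteq> 0" for x
    using alg_hom_closed[OF assms] that by simp
  have mult: "h (x * y) = h x * h y" if "x \<noteq> 0" "y \<noteq> 0" for x y
    using alg_hom_mult[OF assms] that by simp
  obtain q where "q \<in> function_algebra (gens Gm)" "\<forall>x \<in> carrier Gm. h x = q x"
    using alg_hom_regular[OF assms function_algebra.gen[of "\<lambda>x. x"]] by auto
  then obtain P k where P: "\<And>x. x \<noteq> 0 \<Longrightarrow> h x * x ^ k = poly P x"
    using regular_on_Gm_is_Laurent[of q] by auto
  have "poly P 1 \<noteq> 0" using P[of 1] nz[of 1] by simp
  then have "P \<noteq> 0" by auto
  moreover have "poly P (x * y) = poly P x * poly P y" if "x \<noteq> 0" "y \<noteq> 0" for x y
    using P[of x] P[of y] P[of "x * y"] mult[OF that] that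
    by (simp flip: P add: power_mult_distrib mult_ac)
  ultimately obtain d where d: "\<And>x. x \<noteq> 0 \<Longrightarrow> poly P x = x ^ d"
    using multiplicative_polynomial_is_monomial by blast
  have "h x = x powi (int d - int k)" if "x \<noteq> 0" for x
    using P[OF that] d[OF that] that by (simp add: power_int_diff field_simps)
  then show ?thesis by (rule that)
qed

section \<open>Coordinate vectors and the Cartan matrix\<close>

definition nonvanishing :: "(nat \<Rightarrow> 'f::field) \<Rightarrow> bool" where
  "nonvanishing x \<longleftrightarrow> (\<forall>i\<in>{1..7}. x i \<noteq> 0)"

text \<open>The value of the simple root \<open>\<alpha>\<^sub>j\<close> at the element of \<open>T\<close> with coordinates \<open>x\<close>.\<close>

definition root_value :: "(nat \<Rightarrow> 'f::field) \<Rightarrow> nat \<Rightarrow> 'f" where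
  "root_value x j = (\<Prod>i=1..7. x i powi e7_cartan i j)"

lemma one_to_seven: "{1..7::nat} = {1, 2, 3, 4, 5, 6, 7}"
  by auto

lemma e7_adjacent_iff:
  "e7_adjacent i j \<longleftrightarrow>
     (i, j) \<in> {(1,3), (3,1), (3,4), (4,3), (2,4), (4,2), (4,5), (5,4), (5,6), (6,5), (6,7), (7,6)}"
  by (simp add: e7_adjacent_def doubleton_eq_iff)

lemma root_value_simps:
  "root_value x 1 = (x 1)\<^sup>2 / x 3"
  "root_value x 2 = (x 2)\<^sup>2 / x 4"
  "root_value x 3 = (x 3)\<^sup>2 / (x 1 * x 4)"
  "root_value x 4 = (x 4)\<^sup>2 / (x 2 * x 3 * x 5)"
  "root_value x 5 = (x 5)\<^sup>2 / (x 4 * x 6)"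
  "root_value x 6 = (x 6)\<^sup>2 / (x 5 * x 7)"
  "root_value x 7 = (x 7)\<^sup>2 / x 6"
  unfolding root_value_def one_to_seven
  by (simp_all add: e7_cartan_def e7_adjacent_iff power_int_minus field_simps)

lemma power_int_sum_exponent:
  fixes c :: "'f::field"
  assumes "c \<noteq> 0"
  shows "c powi (\<Sum>i\<in>I. n i) = (\<Prod>i\<in>I. c powi n i)"
  using assms by (induction I rule: infinite_finite_induct) (auto simp: power_int_add)

lemma power_int_prod_base:
  fixes x :: "'i \<Rightarrow> 'f::field"
  shows "(\<Prod>i\<in>I. x i) powi n = (\<Prod>i\<in>I. x i powi n)"
  by (induction I rule: infinite_finite_induct) (auto simp: power_int_mult_distrib)

lemma e7_cartan_injective:
  assumes "\<And>l. l \<in> {1..7} \<Longrightarrow> (\<Sum>j=1..7. v j * e7_cartan j l) = (\<Sum>j=1..7. w j * e7_cartan j l)"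
    and "j \<in> {1..7}"
  shows "v j = w j"
  using assms(1)[of 1] assms(1)[of 2] assms(1)[of 3] assms(1)[of 4] assms(1)[of 5]
    assms(1)[of 6] assms(1)[of 7] assms(2)
  unfolding one_to_seven by (simp add: e7_cartan_def e7_adjacent_iff) (elim disjE; simp; linarith)

text \<open>The action of \<open>s\<^sub>i\<close>: since \<open>s\<^sub>i(t) = t \<alpha>\<^sub>i\<^sup>\<or>(\<alpha>\<^sub>i(t))\<^sup>-\<^sup>1\<close>, only the \<open>i\<close>-th coordinate changes.\<close>

definition reflect :: "nat \<Rightarrow> (nat \<Rightarrow> 'f::field) \<Rightarrow> nat \<Rightarrow> 'f" where
  "reflect i x = x(i := x i / root_value x i)"

lemma root_value_nonzero: "nonvanishing x \<Longrightarrow> root_value x i \<noteq> 0"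
  by (simp add: root_value_def nonvanishing_def)

lemma nonvanishing_reflect: "nonvanishing x \<Longrightarrow> nonvanishing (reflect i x)"
  using root_value_nonzero[of x i] by (auto simp: nonvanishing_def reflect_def)

lemma nonvanishing_foldr_reflect: "nonvanishing x \<Longrightarrow> nonvanishing (foldr reflect is x)"
  by (induction "is") (auto intro: nonvanishing_reflect)

lemma nonvanishing_mult: "nonvanishing x \<Longrightarrow> nonvanishing y \<Longrightarrow> nonvanishing (\<lambda>i. x i * y i)"
  by (auto simp: nonvanishing_def)

text \<open>The Cartan matrix has determinant \<open>2\<close>; this is twice its inverse.\<close>

definition e7_double_inverse :: "nat \<Rightarrow> nat \<Rightarrow> int" where
  "e7_double_inverse i j =
     [[4, 4, 6, 8, 6, 4, 2],
      [4, 7, 8, 12, 9, 6, 3],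
      [6, 8, 12, 16, 12, 8, 4],
      [8, 12, 16, 24, 18, 12, 6],
      [6, 9, 12, 18, 15, 10, 5],
      [4, 6, 8, 12, 10, 8, 4],
      [2, 3, 4, 6, 5, 4, 3]] ! (i - 1) ! (j - 1)"

lemma e7_double_inverse_cartan:
  assumes "i \<in> {1..7}" "l \<in> {1..7}"
  shows "(\<Sum>k=1..7. e7_double_inverse i k * e7_cartan k l) = (if i = l then 2 else 0)"
  using assms unfolding one_to_seven
  by (elim insertE emptyE; hypsubst; simp add: e7_double_inverse_def e7_cartan_def e7_adjacent_iff)

text \<open>If \<open>q\<^sub>j\<^sup>2 = z\<^sub>j\<close>, raising the \<open>q\<^sub>j\<close> to the entries of twice the inverse Cartan matrix gives a point
  at which \<open>\<alpha>\<^sub>l\<close> has the value \<open>q\<^sub>l\<^sup>2 = z\<^sub>l\<close>.\<close>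

lemma root_value_surj:
  fixes z :: "nat \<Rightarrow> 'f::alg_closed_field"
  assumes "nonvanishing z"
  obtains x where "nonvanishing x" "\<forall>l\<in>{1..7}. root_value x l = z l"
proof -
  have "\<forall>j. \<exists>q. q ^ 2 = z j" by (intro allI nth_root_exists) simp
  from choice[OF this] obtain q where q: "\<And>j. q j ^ 2 = z j" by blast
  have q0: "q j \<noteq> 0" if "j \<in> {1..7}" for j
    using q[of j] assms that by (auto simp: nonvanishing_def)
  define x where "x k = (\<Prod>j=1..7. q j powi e7_double_inverse j k)" for k
  have "root_value x l = z l" if l: "l \<in> {1..7}" for l
  proof -
    have "root_value x l = (\<Prod>k=1..7. \<Prod>j=1..7. q j powi (e7_double_inverse j k * e7_cartan k l))"
      by (simp only: root_value_def x_def power_int_prod_base power_int_mult)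
    also have "\<dots> = (\<Prod>j=1..7. \<Prod>k=1..7. q j powi (e7_double_inverse j k * e7_cartan k l))"
      by (rule prod.swap)
    also have "\<dots> = (\<Prod>j=1..7. if j = l then q j ^ 2 else 1)"
    proof (rule prod.cong[OF refl])
      fix j :: nat assume j: "j \<in> {1..7}"
      have "(\<Prod>k=1..7. q j powi (e7_double_inverse j k * e7_cartan k l)) =
          q j powi (\<Sum>k=1..7. e7_double_inverse j k * e7_cartan k l)"
        by (rule power_int_sum_exponent[OF q0[OF j], symmetric])
      then show "(\<Prod>k=1..7. q j powi (e7_double_inverse j k * e7_cartan k l)) =
          (if j = l then q j ^ 2 else 1)"
        unfolding e7_double_inverse_cartan[OF j l] by simp
    qed
    also have "\<dots> = z l" using l q by simp
    finally show ?thesis .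
  qed
  moreover have "nonvanishing x" using q0 by (simp add: nonvanishing_def x_def)
  ultimately show ?thesis using that by blast
qed

lemma root_value_mult: "root_value (\<lambda>k. x k * y k) l = root_value x l * root_value y l"
  by (simp add: root_value_def power_int_mult_distrib prod.distrib)

lemma root_value_inverse: "root_value (\<lambda>k. inverse (x k)) l = inverse (root_value x l)"
  by (simp add: root_value_def power_int_inverse prod_inversef[symmetric])

lemma root_value_one: "root_value (\<lambda>_. 1) l = 1"
  by (simp add: root_value_def)

lemma root_value_single:
  assumes "i \<in> {1..7}"
  shows "root_value ((\<lambda>_. 1)(i := c)) l = c powi e7_cartan i l"
proof -
  have "root_value ((\<lambda>_. 1)(i := c)) l = (\<Prod>k=1..7. if k = i then c powi e7_cartan i l else 1)"
    unfolding root_value_def by (rule prod.cong) auto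
  then show ?thesis using assms by simp
qed

lemma root_value_reflect:
  assumes "i \<in> {1..7}" "nonvanishing x"
  shows "root_value (reflect i x) l = root_value x l * root_value x i powi (- e7_cartan i l)"
proof -
  have *: "reflect i x = (\<lambda>k. x k * ((\<lambda>_. 1)(i := inverse (root_value x i))) k)"
    by (auto simp: reflect_def divide_inverse)
  show ?thesis
    unfolding * root_value_mult root_value_single[OF assms(1)]
    by (simp add: power_int_minus power_int_inverse)
qed

lemma e7_cartan_simps [simp]:
  "e7_cartan i i = 2" "e7_adjacent i j \<Longrightarrow> e7_cartan i j = - 1"
  "\<not> e7_adjacent i j \<Longrightarrow> i \<noteq> j \<Longrightarrow> e7_cartan i j = 0"
  by (auto simp: e7_cartan_def e7_adjacent_iff)

lemma e7_adjacentD: "e7_adjacent i j \<Longrightarrow> i \<in> {1..7} \<and> j \<in> {1..7} \<and> i \<noteq> j \<and> e7_adjacent j i"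
  by (auto simp: e7_adjacent_iff)

lemma reflect_same [simp]: "reflect i x i = x i / root_value x i"
  and reflect_other [simp]: "k \<noteq> i \<Longrightarrow> reflect i x k = x k"
  by (simp_all add: reflect_def)

lemma foldr_reflect_other: "k \<notin> set is \<Longrightarrow> foldr reflect is x k = x k"
  by (induction "is") auto

text \<open>Only the coordinates \<open>i\<close> and \<open>j\<close> change; the factors by which they do are what distinguishes these
  words from shorter ones.\<close>

lemma reflect_two:
  assumes "i \<in> {1..7}" "j \<in> {1..7}" "i \<noteq> j" "nonvanishing x"
  shows "foldr reflect [i, j] x j = x j / root_value x j"
    and "foldr reflect [i, j] x i = x i / (root_value x i * root_value x j powi (- e7_cartan j i))"
  using assms by (simp_all add: root_value_reflect)

lemma reflect_three:
  assumes "e7_adjacent i j" "nonvanishing x"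
  shows "foldr reflect [i, j, i] x i = x i / (root_value x i * root_value x j)"
    and "foldr reflect [i, j, i] x j = x j / (root_value x i * root_value x j)"
  using e7_adjacentD[OF assms(1)] assms nonvanishing_reflect[OF assms(2)]
    root_value_nonzero[OF assms(2)]
  by (simp_all add: root_value_reflect power_int_minus field_simps power2_eq_square)

text \<open>Left multiplication by \<open>t\<^sub>i \<sigma>\<^sub>i\<close>, where \<open>t\<^sub>i\<close> has coordinates \<open>Y i\<close>, as it acts on the torus factor of
  an element \<open>t \<sigma>\<^sub>w\<close>.\<close>

definition twisted_reflect :: "(nat \<Rightarrow> nat \<Rightarrow> 'f::field) \<Rightarrow> nat \<Rightarrow> (nat \<Rightarrow> 'f) \<Rightarrow> nat \<Rightarrow> 'f" where
  "twisted_reflect Y i z = (\<lambda>k. Y i k * reflect i z k)"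

lemma reflect_one: "reflect i (\<lambda>_. 1) = (\<lambda>_. 1)"
  by (auto simp: reflect_def root_value_one)

text \<open>The coordinates of \<open>t\<^sub>i\<close> for a section with parameter \<open>x\<close>.\<close>

definition parameter_coords :: "'f::field \<Rightarrow> nat \<Rightarrow> 'f \<Rightarrow> nat \<Rightarrow> 'f" where
  "parameter_coords x i y = (\<lambda>j. if j \<in> {2, 5, 7} then x else 1)(i := y)"

lemma nonvanishing_parameter_coords:
  "x\<^sup>2 = 1 \<Longrightarrow> y \<noteq> 0 \<Longrightarrow> nonvanishing (parameter_coords x i y)"
  by (auto simp: nonvanishing_def parameter_coords_def)

text \<open>This is \<open>t\<^sub>i s\<^sub>i(t\<^sub>i) = 1\<close>.  The root value at \<open>i\<close> is \<open>y\<^sup>2\<close> because an even number of neighbours of \<open>i\<close>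
  carries the coordinate \<open>x\<close>.\<close>

lemma parameter_coords_reflect:
  assumes "x\<^sup>2 = 1" "y \<noteq> 0" "i \<in> {1..7}" "k \<in> {1..7}"
  shows "parameter_coords x i y k * reflect i (parameter_coords x i y) k = 1"
proof (cases "k = i")
  case False
  then show ?thesis using assms(1) by (simp add: parameter_coords_def power2_eq_square)
next
  case True
  have "x \<noteq> 0" using assms(1) by auto
  have "root_value (parameter_coords x i y) i = y\<^sup>2"
    using assms(3) unfolding one_to_seven
    by (elim insertE emptyE; hypsubst;
        simp del: One_nat_def add: root_value_simps parameter_coords_def assms(1)[unfolded power2_eq_square])
  then show ?thesis
    using True assms(2) by (simp add: parameter_coords_def power2_eq_square)
qed

text \<open>The vector \<open>Y i\<close> stands for the coordinates of \<open>t\<^sub>i\<close>.  By \<open>braid1\<close> the coordinate \<open>Y i k\<close>, for fixed \<open>k\<close>,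
  is constant on each connected component of the diagram without the node \<open>k\<close>.  This leaves twelve
  unknowns, one for each pair of a node and such a component, and the remaining equations are
  monomial equations between them.  The first coordinate \<open>A\<close> satisfies \<open>A\<^sup>2 = A\<^sup>3\<close>, and everything
  else is \<open>1\<close> or equal to the seventh coordinate \<open>H\<close>, with \<open>H\<^sup>2 = 1\<close>.\<close>

lemma e7_section_equations:
  fixes Y :: "nat \<Rightarrow> nat \<Rightarrow> 'f::field"
  assumes nv: "\<And>i. i \<in> {1..7} \<Longrightarrow> nonvanishing (Y i)"
    and comm: "\<And>i j. i \<in> {1..7} \<Longrightarrow> j \<in> {1..7} \<Longrightarrow> i \<noteq> j \<Longrightarrow> \<not> e7_adjacent i j \<Longrightarrow>
      root_value (Y j) i = 1"
    and braid1: "\<And>i j k. e7_adjacent i j \<Longrightarrow> k \<in> {1..7} \<Longrightarrow> k \<noteq> i \<Longrightarrow> k \<noteq> j \<Longrightarrow> Y i k = Y j k"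
    and braid2: "\<And>i j. e7_adjacent i j \<Longrightarrow> Y i i = Y j i * root_value (Y i) i * root_value (Y i) j"
  obtains x where "x\<^sup>2 = 1"
    and "\<forall>i\<in>{1..7}. \<forall>k\<in>{1..7}. k \<noteq> i \<longrightarrow> Y i k = (if k \<in> {2, 5, 7} then x else 1)"
proof -
  have nz: "Y i k \<noteq> 0" if "i \<in> {1..7}" "k \<in> {1..7}" for i k
    using nv[OF that(1)] that(2) by (simp add: nonvanishing_def)
  \<comment> \<open>One letter for each node \<open>k\<close>, in the order \<open>1, \<dots>, 7\<close>; primes distinguish the components of the
    diagram without \<open>k\<close>.\<close>
  define A where "A = Y 3 1"
  define B where "B = Y 4 2"
  define C where "C = Y 4 3"
  define C' where "C' = Y 1 3"
  define D where "D = Y 5 4"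
  define D' where "D' = Y 3 4"
  define D'' where "D'' = Y 2 4"
  define E where "E = Y 4 5"
  define E' where "E' = Y 6 5"
  define F where "F = Y 5 6"
  define F' where "F' = Y 7 6"
  define H where "H = Y 6 7"
  note names = A_def B_def C_def C'_def D_def D'_def D''_def E_def E'_def F_def F'_def H_def
  have nz': "A \<noteq> 0" "B \<noteq> 0" "C \<noteq> 0" "C' \<noteq> 0" "D \<noteq> 0" "D' \<noteq> 0" "D'' \<noteq> 0" "E \<noteq> 0" "E' \<noteq> 0"
    "F \<noteq> 0" "F' \<noteq> 0" "H \<noteq> 0"
    by (simp_all add: names nz)
  have col1A: "Y 4 1 = A" "Y 2 1 = A" "Y 5 1 = A" "Y 6 1 = A" "Y 7 1 = A"
    using braid1[of 3 4 1] braid1[of 4 2 1] braid1[of 4 5 1] braid1[of 5 6 1] braid1[of 6 7 1]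
    by (simp_all del: One_nat_def add: e7_adjacent_iff names)
  have col2B: "Y 3 2 = B" "Y 1 2 = B" "Y 5 2 = B" "Y 6 2 = B" "Y 7 2 = B"
    using braid1[of 4 3 2] braid1[of 3 1 2] braid1[of 4 5 2] braid1[of 5 6 2] braid1[of 6 7 2]
    by (simp_all del: One_nat_def add: e7_adjacent_iff names)
  have col7H: "Y 5 7 = H" "Y 4 7 = H" "Y 3 7 = H" "Y 2 7 = H" "Y 1 7 = H"
    using braid1[of 6 5 7] braid1[of 5 4 7] braid1[of 4 3 7] braid1[of 4 2 7] braid1[of 3 1 7]
    by (simp_all del: One_nat_def add: e7_adjacent_iff names)
  have col3C: "Y 2 3 = C" "Y 5 3 = C" "Y 6 3 = C" "Y 7 3 = C"
    using braid1[of 4 2 3] braid1[of 4 5 3] braid1[of 5 6 3] braid1[of 6 7 3]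
    by (simp_all del: One_nat_def add: e7_adjacent_iff names)
  have col4Dp: "Y 1 4 = D'"
    using braid1[of 3 1 4]
    by (simp_all del: One_nat_def add: e7_adjacent_iff names)
  have col4D: "Y 6 4 = D" "Y 7 4 = D"
    using braid1[of 5 6 4] braid1[of 6 7 4]
    by (simp_all del: One_nat_def add: e7_adjacent_iff names)
  have col5E: "Y 2 5 = E" "Y 3 5 = E" "Y 1 5 = E"
    using braid1[of 4 2 5] braid1[of 4 3 5] braid1[of 3 1 5]
    by (simp_all del: One_nat_def add: e7_adjacent_iff names)
  have col5Ep: "Y 7 5 = E'"
    using braid1[of 6 7 5]
    by (simp_all del: One_nat_def add: e7_adjacent_iff names)
  have col6F: "Y 4 6 = F" "Y 2 6 = F" "Y 3 6 = F" "Y 1 6 = F"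
    using braid1[of 5 4 6] braid1[of 4 2 6] braid1[of 4 3 6] braid1[of 3 1 6]
    by (simp_all del: One_nat_def add: e7_adjacent_iff names)
  note cols = col1A col2B col7H col3C col4Dp col4D col5E col5Ep col6F names[symmetric]
  \<comment> \<open>The equations \<open>\<alpha>\<^sub>i(t\<^sub>j) = 1\<close> for nonadjacent \<open>i\<close> and \<open>j\<close>.\<close>
  have c1: "A\<^sup>2 = C"
    using comm[of 1 2] nz' by (simp del: One_nat_def add: e7_adjacent_iff root_value_simps cols)
  have c2: "B\<^sup>2 = D'"
    using comm[of 2 1] nz' by (simp del: One_nat_def add: e7_adjacent_iff root_value_simps cols)
  have c3: "B\<^sup>2 = D"
    using comm[of 2 5] nz' by (simp del: One_nat_def add: e7_adjacent_iff root_value_simps cols)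
  have c4: "H\<^sup>2 = F"
    using comm[of 7 1] nz' by (simp del: One_nat_def add: e7_adjacent_iff root_value_simps cols)
  have c5: "C\<^sup>2 = A * D"
    using comm[of 3 5] nz' by (simp del: One_nat_def add: e7_adjacent_iff root_value_simps cols)
  have c6: "C\<^sup>2 = A * D''"
    using comm[of 3 2] nz' by (simp del: One_nat_def add: e7_adjacent_iff root_value_simps cols)
  have c7: "D'\<^sup>2 = B * C' * E"
    using comm[of 4 1] nz' by (simp del: One_nat_def add: e7_adjacent_iff root_value_simps cols)
  have c8: "D\<^sup>2 = B * C * E'"
    using comm[of 4 6] nz' by (simp del: One_nat_def add: e7_adjacent_iff root_value_simps cols)
  have c9: "E\<^sup>2 = D'' * F"
    using comm[of 5 2] nz' by (simp del: One_nat_def add: e7_adjacent_iff root_value_simps cols)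
  have c10: "F\<^sup>2 = E * H"
    using comm[of 6 1] nz' by (simp del: One_nat_def add: e7_adjacent_iff root_value_simps cols)
  have cancel: "y = z" if "w * y = w * z" "w \<noteq> 0" for w y z :: 'f
    using that by simp
  \<comment> \<open>In the equations of adjacent nodes the unconstrained entry \<open>Y i i\<close> cancels.\<close>
  have "Y 3 1 * root_value (Y 1) 1 * root_value (Y 1) 3 = Y 1 1 * (A * C' / D')"
    using nz' nz[of 1 1]
    by (simp del: One_nat_def add: root_value_simps cols power2_eq_square mult_ac)
  then have b1: "D' = A * C'"
    using braid2[of 1 3] nz' nz[of 1 1] cancel[of "Y 1 1" 1 "A * C' / D'"]
    by (simp add: e7_adjacent_iff field_simps)
  have "Y 4 3 * root_value (Y 3) 3 * root_value (Y 3) 4 = Y 3 3 * (C * D' / (A * B * E))"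
    using nz' nz[of 3 3]
    by (simp del: One_nat_def add: root_value_simps cols power2_eq_square mult_ac)
  then have b2: "C * D' = A * B * E"
    using braid2[of 3 4] nz' nz[of 3 3] cancel[of "Y 3 3" 1 "C * D' / (A * B * E)"]
    by (simp add: e7_adjacent_iff field_simps)
  have "Y 5 4 * root_value (Y 4) 4 * root_value (Y 4) 5 = Y 4 4 * (D * E / (B * C * F))"
    using nz' nz[of 4 4]
    by (simp del: One_nat_def add: root_value_simps cols power2_eq_square mult_ac)
  then have b3: "D * E = B * C * F"
    using braid2[of 4 5] nz' nz[of 4 4] cancel[of "Y 4 4" 1 "D * E / (B * C * F)"]
    by (simp add: e7_adjacent_iff field_simps)
  have "Y 7 6 * root_value (Y 6) 6 * root_value (Y 6) 7 = Y 6 6 * (F' * H / E')"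
    using nz' nz[of 6 6]
    by (simp del: One_nat_def add: root_value_simps cols power2_eq_square mult_ac)
  then have b4: "E' = F' * H"
    using braid2[of 6 7] nz' nz[of 6 6] cancel[of "Y 6 6" 1 "F' * H / E'"]
    by (simp add: e7_adjacent_iff field_simps)
  \<comment> \<open>Elimination: \<open>C\<close>, \<open>C'\<close>, \<open>D\<close>, \<open>D'\<close>, \<open>D''\<close> become powers of \<open>A\<close>, and \<open>E\<close>, \<open>F\<close> powers of \<open>H\<close>; then \<open>A\<close>,
    \<open>B\<close> and \<open>H\<close> are compared.\<close>
  have "A * D = (A\<^sup>2)\<^sup>2" using c1 c5 by simp
  then have "A * D = A * A ^ 3" by (simp add: eval_nat_numeral)
  then have D: "D = A ^ 3" by (rule cancel) (simp add: nz')
  have "A * D'' = A * D" using c5 c6 by simp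
  then have D'': "D'' = A ^ 3" unfolding D by (rule cancel) (simp add: nz')
  have "A * C' = A ^ 3" using D c2 c3 b1 by simp
  then have "A * C' = A * A\<^sup>2" by (simp add: eval_nat_numeral)
  then have C': "C' = A\<^sup>2" by (rule cancel) (simp add: nz')
  have "H * E = (H\<^sup>2)\<^sup>2" using c4 c10 by simp
  then have "H * E = H * H ^ 3" by (simp add: eval_nat_numeral)
  then have E: "E = H ^ 3" by (rule cancel) (simp add: nz')
  have "(H ^ 3)\<^sup>2 = B\<^sup>2 * H\<^sup>2" using c9 E D'' D c3 c4 by simp
  then have "H\<^sup>2 * H ^ 4 = H\<^sup>2 * B\<^sup>2" by (simp add: eval_nat_numeral mult_ac)
  then have HB: "H ^ 4 = B\<^sup>2" by (rule cancel) (simp add: nz')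
  have "A\<^sup>2 * B\<^sup>2 = A * B * H ^ 3" using b2 unfolding E c1 c2 .
  then have "(A * B) * (A * B) = (A * B) * H ^ 3" by (simp add: eval_nat_numeral mult_ac)
  then have AB: "A * B = H ^ 3" by (rule cancel) (simp add: nz')
  have "D' = D" using c2 c3 by simp
  then have "B * C * E' = B * C' * E" using c7 c8 by simp
  then have E': "C * E' = C * H ^ 3" using nz' by (simp add: C' E c1 mult.assoc)
  have "B\<^sup>2 * H ^ 3 = B * A\<^sup>2 * H\<^sup>2" using b3 unfolding E c1 c3 c4 .
  then have "(B * H\<^sup>2) * A\<^sup>2 = (B * H\<^sup>2) * (B * H)" by (auto simp: eval_nat_numeral mult_ac)
  then have AH: "A\<^sup>2 = B * H" by (rule cancel) (simp add: nz')
  have "B\<^sup>2 * A\<^sup>2 = (A * B)\<^sup>2" by (simp add: power_mult_distrib mult.commute)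
  also have "\<dots> = H ^ 4 * H\<^sup>2" unfolding AB by (simp add: eval_nat_numeral)
  finally have "B\<^sup>2 * A\<^sup>2 = B\<^sup>2 * H\<^sup>2" unfolding HB .
  then have A2: "A\<^sup>2 = H\<^sup>2" by (rule cancel) (simp add: nz')
  have BH: "B = H" using AH A2 nz' by (simp add: power2_eq_square)
  have "A ^ 3 = A\<^sup>2" using D c3 BH A2 by simp
  then have "A\<^sup>2 * A = A\<^sup>2 * 1" by (simp add: eval_nat_numeral)
  then have A: "A = 1" by (rule cancel) (simp add: nz')
  have H: "H\<^sup>2 = 1" using A A2 by simp
  have H3: "H ^ 3 = H" using H by (simp add: power3_eq_cube power2_eq_square)
  have F': "F' = 1" using E' b4 A H3 nz' by simp
  have vals: "A = 1" "B = H" "C = 1" "C' = 1" "D = 1" "D' = 1" "D'' = 1" "E = H" "E' = H"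
    "F = 1" "F' = 1"
    using A BH c1 C' D c2 D'' E E' c4 F' H H3 by simp_all
  show ?thesis
    by (rule that[OF H]) (unfold one_to_seven, simp del: One_nat_def add: cols vals)
qed

section \<open>The simple coroots as coordinates on the torus\<close>

locale e7_group =
  fixes G T :: "('f::alg_closed_field ^ 'n ^ 'n) set"
    and cr u :: "('f ^ 'n ^ 'n \<Rightarrow> 'f) \<Rightarrow> 'f \<Rightarrow> 'f ^ 'n ^ 'n"
    and a :: "nat \<Rightarrow> 'f ^ 'n ^ 'n \<Rightarrow> 'f"
  assumes setting: "simply_connected_E7_setting G T cr u a"
begin

abbreviation "coords \<equiv> torus_coords cr a"

lemma subgroup_G: "subgroup G GL"
  using setting by (auto simp: simply_connected_E7_setting_def connected_reductive_def
    closed_subgroup_def)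

lemma torus_T: "torus T" and T_subset_G: "T \<subseteq> G"
  using setting by (auto simp: simply_connected_E7_setting_def maximal_torus_def)

lemma subgroup_T: "subgroup T GL"
  using torus_T by (simp add: torus_def closed_subgroup_def)

lemma G_invertible: "g \<in> G \<Longrightarrow> invertible g"
  using subgroup.subset[OF subgroup_G] by auto

lemma T_invertible: "t \<in> T \<Longrightarrow> invertible t"
  using T_subset_G G_invertible by blast

lemma T_mult: "s \<in> T \<Longrightarrow> t \<in> T \<Longrightarrow> s ** t \<in> T"
  using subgroup.m_closed[OF subgroup_T] by simp

lemma T_one: "mat 1 \<in> T"
  using subgroup.one_closed[OF subgroup_T] by simp

lemma T_inv: "t \<in> T \<Longrightarrow> matrix_inv t \<in> T"
  using subgroup.m_inv_closed[OF subgroup_T] inv_GL[OF T_invertible] by metis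

lemma T_commute:
  assumes "s \<in> T" "t \<in> T"
  shows "s ** t = t ** s"
proof -
  obtain r f where f: "f \<in> alg_iso (Gm_power r) (sub T)"
    using torus_T by (auto simp: torus_def)
  then have hom: "f \<in> alg_hom (Gm_power r) (sub T)" and
    bij: "bij_betw f (carrier (Gm_power r)) T" by (simp_all add: alg_iso_def)
  obtain x y where xy: "x \<in> carrier (Gm_power r)" "y \<in> carrier (Gm_power r)" "s = f x" "t = f y"
    using assms bij_betw_imp_surj_on[OF bij] by blast
  have "x \<otimes>\<^bsub>Gm_power r\<^esub> y = y \<otimes>\<^bsub>Gm_power r\<^esub> x"
    by (simp add: Gm_power_def mult.commute)
  then show ?thesis
    using alg_hom_mult[OF hom xy(1,2)] alg_hom_mult[OF hom xy(2,1)] xy(3,4) by simp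
qed

lemma simple_root: "i \<in> {1..7} \<Longrightarrow> a i \<in> roots G T"
  using setting by (auto simp: simply_connected_E7_setting_def e7_base_def)

lemma realization_at:
  assumes "\<alpha> \<in> roots G T"
  shows "is_coroot G T \<alpha> (cr \<alpha>)" "root_isomorphism G T \<alpha> (u \<alpha>)"
    "tits_element T u \<alpha> \<in> normalizer (sub G) T"
    "induces_reflection T \<alpha> (cr \<alpha>) (tits_element T u \<alpha>)"
    "x \<noteq> 0 \<Longrightarrow> u \<alpha> x ** u (neg_char T \<alpha>) (- inverse x) ** u \<alpha> x = cr \<alpha> x ** tits_element T u \<alpha>"
  using setting assms by (simp_all add: simply_connected_E7_setting_def realization_def)

lemma root_hom:
  assumes "\<alpha> \<in> roots G T"
  shows "\<alpha> \<in> alg_hom (sub T) Gm"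
  using assms by (simp add: roots_def characters_def)

lemma root_mult:
  assumes "\<alpha> \<in> roots G T" "s \<in> T" "t \<in> T"
  shows "\<alpha> (s ** t) = \<alpha> s * \<alpha> t"
  using alg_hom_mult[OF root_hom[OF assms(1)], of s t] assms(2,3) by simp

lemma root_nonzero: "\<alpha> \<in> roots G T \<Longrightarrow> t \<in> T \<Longrightarrow> \<alpha> t \<noteq> 0"
  using alg_hom_closed[OF root_hom, of \<alpha> t] by simp

lemma root_one:
  assumes "\<alpha> \<in> roots G T"
  shows "\<alpha> (mat 1) = 1"
  using root_mult[OF assms T_one T_one] root_nonzero[OF assms T_one] by simp

lemma coroot_hom:
  assumes "\<alpha> \<in> roots G T"
  shows "cr \<alpha> \<in> alg_hom Gm (sub T)"
  using realization_at(1)[OF assms] by (simp add: is_coroot_def cocharacters_def)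

lemma coroot_in_T: "\<alpha> \<in> roots G T \<Longrightarrow> x \<noteq> 0 \<Longrightarrow> cr \<alpha> x \<in> T"
  using alg_hom_closed[OF coroot_hom, of \<alpha> x] by simp

lemma coroot_mult: "\<alpha> \<in> roots G T \<Longrightarrow> x \<noteq> 0 \<Longrightarrow> y \<noteq> 0 \<Longrightarrow> cr \<alpha> (x * y) = cr \<alpha> x ** cr \<alpha> y"
  using alg_hom_mult[OF coroot_hom, of \<alpha> x y] by simp

lemma coroot_one:
  assumes "\<alpha> \<in> roots G T"
  shows "cr \<alpha> 1 = mat 1"
proof -
  have "cr \<alpha> 1 ** cr \<alpha> 1 = cr \<alpha> 1" using coroot_mult[OF assms, of 1 1] by simp
  then show ?thesis
    using T_invertible[OF coroot_in_T[OF assms, of 1]]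
    by (metis matrix_inv_inverse(2) matrix_mul_assoc matrix_mul_lid one_neq_zero)
qed

lemma root_coroot:
  "i \<in> {1..7} \<Longrightarrow> j \<in> {1..7} \<Longrightarrow> x \<noteq> 0 \<Longrightarrow> a j (cr (a i) x) = x powi e7_cartan i j"
  using setting by (auto simp: simply_connected_E7_setting_def e7_base_def)

lemma foldr_in_T:
  "(\<And>i. i \<in> set is \<Longrightarrow> g i \<in> T) \<Longrightarrow> foldr (**) (map g is) (mat 1) \<in> T"
  by (induction "is") (auto intro: T_mult T_one)

lemma foldr_mult_T:
  assumes "\<And>i. i \<in> set is \<Longrightarrow> g i \<in> T" "\<And>i. i \<in> set is \<Longrightarrow> h i \<in> T"
  shows "foldr (**) (map (\<lambda>i. g i ** h i) is) (mat 1) =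
    foldr (**) (map g is) (mat 1) ** foldr (**) (map h is) (mat 1)"
  using assms
proof (induction "is")
  case (Cons i "is")
  let ?g = "foldr (**) (map g is) (mat 1)" and ?h = "foldr (**) (map h is) (mat 1)"
  have "g i ** h i ** (?g ** ?h) = g i ** (h i ** ?g) ** ?h" by (simp add: matrix_mul_assoc)
  also have "h i ** ?g = ?g ** h i" using Cons.prems by (intro T_commute foldr_in_T) auto
  finally show ?case using Cons by (simp add: matrix_mul_assoc)
qed simp

lemma multiplicative_foldr:
  assumes "\<And>i. i \<in> set is \<Longrightarrow> g i \<in> T" "p \<in> alg_hom (sub T) Gm"
  shows "p (foldr (**) (map g is) (mat 1)) = (\<Prod>i\<leftarrow>is. p (g i))"
  using assms(1)
proof (induction "is")
  case Nil
  have "p (mat 1 ** mat 1) = p (mat 1) * p (mat 1)"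
    using alg_hom_mult[OF assms(2), of "mat 1" "mat 1"] T_one by simp
  then show ?case using alg_hom_closed[OF assms(2), of "mat 1"] T_one by simp
next
  case (Cons i "is")
  then show ?case
    using alg_hom_mult[OF assms(2), of "g i" "foldr (**) (map g is) (mat 1)"] foldr_in_T[of "is" g]
    by simp
qed

lemma set_upt_8: "set [1..<8] = {1..7::nat}"
  by auto

lemma coords_in_T: "nonvanishing x \<Longrightarrow> coords x \<in> T"
  unfolding torus_coords_def
  by (rule foldr_in_T) (auto simp: nonvanishing_def intro!: coroot_in_T simple_root)

lemma coords_cong: "(\<And>i. i \<in> {1..7} \<Longrightarrow> x i = y i) \<Longrightarrow> coords x = coords y"
  unfolding torus_coords_def by (intro arg_cong[of _ _ "\<lambda>l. foldr (**) l (mat 1)"] map_cong) auto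

lemma coords_mult:
  assumes "nonvanishing x" "nonvanishing y"
  shows "coords x ** coords y = coords (\<lambda>i. x i * y i)"
proof -
  have "coords (\<lambda>i. x i * y i) = foldr (**) (map (\<lambda>i. cr (a i) (x i) ** cr (a i) (y i)) [1..<8]) (mat 1)"
    unfolding torus_coords_def
    by (intro arg_cong[of _ _ "\<lambda>l. foldr (**) l (mat 1)"] map_cong refl coroot_mult simple_root)
       (use assms in \<open>auto simp: nonvanishing_def\<close>)
  also have "\<dots> = coords x ** coords y"
    unfolding torus_coords_def
    by (rule foldr_mult_T) (use assms in \<open>auto simp: nonvanishing_def intro!: coroot_in_T simple_root\<close>)
  finally show ?thesis ..
qed

lemma coords_one: "coords (\<lambda>_. 1) = mat 1"
proof -
  have "foldr (**) (map (\<lambda>i. cr (a i) 1) is) (mat 1) = mat 1" if "set is \<subseteq> {1..7}" for "is"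
    using that by (induction "is") (auto simp: coroot_one simple_root)
  then show ?thesis by (simp only: torus_coords_def set_upt_8 subset_refl)
qed

lemma character_coords:
  assumes "nonvanishing x" "p \<in> alg_hom (sub T) Gm"
  shows "p (coords x) = (\<Prod>i=1..7. p (cr (a i) (x i)))"
proof -
  have "p (coords x) = (\<Prod>i\<leftarrow>[1..<8]. p (cr (a i) (x i)))"
    unfolding torus_coords_def using assms
    by (intro multiplicative_foldr coroot_in_T simple_root) (auto simp: nonvanishing_def)
  also have "\<dots> = (\<Prod>i\<in>set [1..<8]. p (cr (a i) (x i)))"
    by (rule prod.distinct_set_conv_list[symmetric]) simp
  finally show ?thesis by (simp only: set_upt_8)
qed

lemma root_coords:
  assumes "nonvanishing x" "j \<in> {1..7}"
  shows "a j (coords x) = root_value x j"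
  unfolding root_value_def character_coords[OF assms(1) root_hom[OF simple_root[OF assms(2)]]]
  using assms by (intro prod.cong) (auto simp: root_coroot nonvanishing_def)

lemma coroot_eq_coords:
  assumes "i \<in> {1..7}" "c \<noteq> 0"
  shows "cr (a i) c = coords ((\<lambda>_. 1)(i := c))"
proof -
  have *: "foldr (**) (map (\<lambda>j. cr (a j) (((\<lambda>_. 1)(i := c)) j)) is) (mat 1) =
    (if i \<in> set is then cr (a i) c else mat 1)" if "set is \<subseteq> {1..7}" "distinct is" for "is"
    using that by (induction "is") (auto simp: coroot_one simple_root)
  have "coords ((\<lambda>_. 1)(i := c)) = (if i \<in> set [1..<8] then cr (a i) c else mat 1)"
    unfolding torus_coords_def by (rule *) auto
  then show ?thesis using assms(1) by auto
qed

text \<open>Fix an isomorphism \<open>T \<cong> G\<^sub>m\<^sup>r\<close> with coordinate characters \<open>p\<^sub>k\<close>.  By simple connectedness the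
  coordinate cocharacters are integral combinations of the simple coroots, with coefficient matrix
  \<open>m\<close>; conversely, the characters \<open>p\<^sub>k \<circ> \<alpha>\<^sub>i\<^sup>\<or>\<close> of \<open>G\<^sub>m\<close> are powers, with exponents \<open>n\<close>.\<close>

lemma torus_lattice:
  obtains r :: nat and p :: "nat \<Rightarrow> 'f ^ 'n ^ 'n \<Rightarrow> 'f"
    and m n :: "nat \<Rightarrow> nat \<Rightarrow> int"
  where "\<forall>k<r. p k \<in> alg_hom (sub T) Gm"
    and "\<forall>t\<in>T. t = coords (\<lambda>j. \<Prod>k<r. p k t powi m k j)"
    and "\<forall>i\<in>{1..7}. \<forall>k<r. \<forall>c. c \<noteq> 0 \<longrightarrow> p k (cr (a i) c) = c powi n i k"
proof -
  obtain r f where f: "f \<in> alg_iso (Gm_power r) (sub T)"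
    using torus_T by (auto simp: torus_def)
  define fi where "fi = inv_into (carrier (Gm_power r)) f"
  have hom: "f \<in> alg_hom (Gm_power r) (sub T)" and ihom: "fi \<in> alg_hom (sub T) (Gm_power r)" and
    bij: "bij_betw f (carrier (Gm_power r)) T" using f by (simp_all add: alg_iso_def fi_def)
  have f_fi: "f (fi t) = t" if "t \<in> T" for t
    using bij that unfolding fi_def by (rule bij_betw_inv_into_right)
  define p where "p k t = fi t k" for k t
  have p_hom: "p k \<in> alg_hom (sub T) Gm" if "k < r" for k
  proof -
    have "(\<lambda>x. x k :: 'f) \<in> alg_hom (Gm_power r) Gm"
    proof (rule alg_homI)
      show "(\<lambda>x. x k :: 'f) \<in> hom (Gm_power r) Gm"
        using that by (auto simp: hom_def Gm_power_def)
    next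
      fix y :: "'f \<Rightarrow> 'f" assume "y \<in> gens Gm"
      then have "(\<lambda>x. y (x k)) \<in> gens (Gm_power r)"
        using that by (auto simp: Gm_power_def)
      then show "\<exists>q\<in>function_algebra (gens (Gm_power r)). \<forall>x\<in>carrier (Gm_power r). y (x k) = q x"
        by (intro bexI[OF _ function_algebra.gen]) auto
    qed
    from alg_hom_compose[OF ihom this] show ?thesis by (simp add: p_def[abs_def])
  qed
  \<comment> \<open>The \<open>k\<close>-th coordinate cocharacter of \<open>G\<^sub>m\<^sup>r\<close>.\<close>
  define single where "single k c = (\<lambda>i\<in>{..<r}. if i = k then c else 1)" for k and c :: 'f
  have "\<exists>e. \<forall>c. c \<noteq> 0 \<longrightarrow> f (single k c) = coords (\<lambda>i. c powi e i)" if "k < r" for k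
  proof -
    have "single k \<in> alg_hom Gm (Gm_power r)"
    proof (rule alg_homI)
      show "single k \<in> hom Gm (Gm_power r)"
        using that by (auto simp: hom_def Gm_power_def single_def)
    next
      fix y :: "(nat \<Rightarrow> 'f) \<Rightarrow> 'f" assume "y \<in> gens (Gm_power r)"
      then obtain i where i: "i < r" "y = (\<lambda>x. x i) \<or> y = (\<lambda>x. inverse (x i))"
        by (auto simp: Gm_power_def)
      show "\<exists>q\<in>function_algebra (gens Gm). \<forall>c\<in>carrier Gm. y (single k c) = q c"
      proof (cases "i = k")
        case True
        then have "(\<lambda>c. y (single k c)) \<in> gens Gm" using i by (auto simp: single_def)
        then show ?thesis by (intro bexI[OF _ function_algebra.gen]) auto
      next
        case False
        then show ?thesis using i
          by (intro bexI[OF _ function_algebra.const[of 1]]) (auto simp: single_def)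
      qed
    qed
    then have "(\<lambda>c. f (single k c)) \<in> cocharacters T"
      unfolding cocharacters_def using hom by (rule alg_hom_compose)
    then show ?thesis
      using setting by (auto simp: simply_connected_E7_setting_def simply_connected_e7_def)
  qed
  then have "\<forall>k. \<exists>e. k < r \<longrightarrow> (\<forall>c. c \<noteq> 0 \<longrightarrow> f (single k c) = coords (\<lambda>i. c powi e i))" by blast
  from choice[OF this] obtain m
    where m: "\<And>k c. k < r \<Longrightarrow> c \<noteq> 0 \<Longrightarrow> f (single k c) = coords (\<lambda>i. c powi m k i)"
    by blast
  have f_coords: "f x = coords (\<lambda>j. \<Prod>k<r. x k powi m k j)" if x: "x \<in> carrier (Gm_power r)" for x
  proof -
    have nz: "x k \<noteq> 0" if "k < r" for k using x that by (auto simp: Gm_power_def)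
    \<comment> \<open>A point of \<open>G\<^sub>m\<^sup>r\<close> is built up coordinate by coordinate.\<close>
    define trunc where "trunc s = (\<lambda>i\<in>{..<r}. if i < s then x i else 1)" for s
    have trunc_in: "trunc s \<in> carrier (Gm_power r)" for s
      using nz by (auto simp: Gm_power_def trunc_def restrict_PiE_iff)
    have "f (trunc s) = coords (\<lambda>j. \<Prod>k<s. x k powi m k j)" if "s \<le> r" for s
      using that
    proof (induction s)
      case 0
      have "trunc 0 \<otimes>\<^bsub>Gm_power r\<^esub> trunc 0 = trunc 0"
        by (auto simp: Gm_power_def trunc_def)
      then have "f (trunc 0) ** f (trunc 0) = f (trunc 0)"
        using alg_hom_mult[OF hom trunc_in[of 0] trunc_in[of 0]] by simp
      moreover have "invertible (f (trunc 0))"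
        using alg_hom_closed[OF hom trunc_in[of 0]] T_invertible by simp
      ultimately have "f (trunc 0) = mat 1"
        by (metis matrix_inv_inverse(2) matrix_mul_assoc matrix_mul_lid)
      then show ?case using coords_one by simp
    next
      case (Suc s)
      have s: "s < r" using Suc.prems by simp
      have "single s (x s) \<in> carrier (Gm_power r)"
        using nz[OF s] by (auto simp: Gm_power_def single_def)
      moreover have "trunc (Suc s) = trunc s \<otimes>\<^bsub>Gm_power r\<^esub> single s (x s)"
        by (auto simp: Gm_power_def trunc_def single_def less_Suc_eq fun_eq_iff)
      ultimately have "f (trunc (Suc s)) = f (trunc s) ** f (single s (x s))"
        using alg_hom_mult[OF hom trunc_in[of s]] by simp
      also have "\<dots> = coords (\<lambda>j. \<Prod>k<s. x k powi m k j) ** coords (\<lambda>j. x s powi m s j)"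
        using Suc m[OF s nz[OF s]] by simp
      also have "\<dots> = coords (\<lambda>j. (\<Prod>k<s. x k powi m k j) * x s powi m s j)"
        by (rule coords_mult) (use s nz in \<open>auto simp: nonvanishing_def\<close>)
      finally show ?case by simp
    qed
    from this[of r] have "f (trunc r) = coords (\<lambda>j. \<Prod>k<r. x k powi m k j)" by simp
    moreover have "trunc r = x" using x by (auto simp: trunc_def Gm_power_def PiE_def extensional_def)
    ultimately show ?thesis by simp
  qed
  have "t = coords (\<lambda>j. \<Prod>k<r. p k t powi m k j)" if "t \<in> T" for t
    using f_coords[of "fi t"] f_fi[OF that] alg_hom_closed[OF ihom, of t] that
    by (simp add: p_def)
  moreover have "\<exists>e. \<forall>c. c \<noteq> 0 \<longrightarrow> p k (cr (a i) c) = c powi e" if "i \<in> {1..7}" "k < r" for i k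
    using Gm_character_is_power[OF alg_hom_compose[OF coroot_hom[OF simple_root[OF that(1)]]
      p_hom[OF that(2)]]] by metis
  then obtain n where "\<And>i k c. i \<in> {1..7} \<Longrightarrow> k < r \<Longrightarrow> c \<noteq> 0 \<Longrightarrow> p k (cr (a i) c) = c powi n i k"
    by metis
  ultimately show ?thesis by (intro that[of r p m n]) (use p_hom in auto)
qed

lemma coords_surj:
  assumes "t \<in> T"
  obtains x where "nonvanishing x" "t = coords x"
proof -
  obtain r p m n where p': "\<forall>k<r::nat. p k \<in> alg_hom (sub T) Gm"
    and m': "\<forall>t\<in>T. t = coords (\<lambda>j. \<Prod>k<r. p k t powi m k j)"
    and n': "\<forall>i\<in>{1..7}. \<forall>k<r. \<forall>c. c \<noteq> 0 \<longrightarrow> p k (cr (a i) c) = c powi n i k"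
    by (rule torus_lattice)
  note p = p'[rule_format] and m = m'[rule_format]
  have "p k t \<noteq> 0" if "k < r" for k using alg_hom_closed[OF p[OF that], of t] assms by simp
  then show ?thesis
    using that[OF _ m[OF assms]] by (auto simp: nonvanishing_def)
qed

text \<open>Expressing \<open>\<alpha>\<^sub>i\<^sup>\<or>\<close> through the coordinate cocharacters and these again through simple coroots gives
  the exponent matrix \<open>M = nm\<close>.  Evaluating the simple roots, \<open>M\<close> and the identity have the same
  product with the Cartan matrix, which is invertible over the rationals, so \<open>M = 1\<close>.  Hence the
  coordinates of a point of \<open>T\<close> are monomials in the values of the characters \<open>p\<^sub>k\<close> at that point.\<close>

lemma coords_inj:
  assumes x: "nonvanishing x" and y: "nonvanishing y" and eq: "coords x = coords y"
    and "j \<in> {1..7}"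
  shows "x j = y j"
proof -
  obtain r p m n where p': "\<forall>k<r::nat. p k \<in> alg_hom (sub T) Gm"
    and m': "\<forall>t\<in>T. t = coords (\<lambda>j. \<Prod>k<r. p k t powi m k j)"
    and n': "\<forall>i\<in>{1..7}. \<forall>k<r. \<forall>c. c \<noteq> 0 \<longrightarrow> p k (cr (a i) c) = c powi n i k"
    by (rule torus_lattice)
  note p = p'[rule_format] and m = m'[rule_format] and n = n'[rule_format]
  define M where "M i j = (\<Sum>k<r. n i k * m k j)" for i j
  have M: "M i j = of_bool (i = j)" if i: "i \<in> {1..7}" and j: "j \<in> {1..7}" for i j
  proof (rule e7_cartan_injective[OF _ j])
    fix l :: nat assume l: "l \<in> {1..7}"
    have "c powi (\<Sum>j=1..7. M i j * e7_cartan j l) = c powi e7_cartan i l" if c: "c \<noteq> 0" for c :: 'f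
    proof -
      have "cr (a i) c = coords (\<lambda>j. \<Prod>k<r. p k (cr (a i) c) powi m k j)"
        by (rule m[OF coroot_in_T[OF simple_root[OF i] c]])
      also have "\<dots> = coords (\<lambda>j. c powi M i j)"
        by (rule coords_cong)
           (use c in \<open>simp add: n[OF i] M_def power_int_sum_exponent power_int_mult\<close>)
      finally have "a l (cr (a i) c) = root_value (\<lambda>j. c powi M i j) l"
        using root_coords[OF _ l] c by (simp add: nonvanishing_def)
      then show ?thesis
        using root_coroot[OF i l c] c
        by (simp add: root_value_def power_int_sum_exponent power_int_mult)
    qed
    then have "(\<Sum>j=1..7. M i j * e7_cartan j l) = e7_cartan i l"
      by (rule powi_eq_imp_exponents_eq)
    also have "\<dots> = (\<Sum>j=1..7. of_bool (i = j) * e7_cartan j l)"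
      using i by (simp add: of_bool_def if_distrib[of "\<lambda>z. z * _"] cong: if_cong)
    finally show "(\<Sum>j=1..7. M i j * e7_cartan j l) = (\<Sum>j=1..7. of_bool (i = j) * e7_cartan j l)" .
  qed
  have recover: "z j = (\<Prod>k<r. p k (coords z) powi m k j)" if z: "nonvanishing z" for z
  proof -
    have "(\<Prod>k<r. p k (coords z) powi m k j) = (\<Prod>k<r. \<Prod>i=1..7. z i powi (n i k * m k j))"
    proof (rule prod.cong[OF refl])
      fix k assume "k \<in> {..<r}"
      then have k: "k < r" by simp
      have "p k (coords z) = (\<Prod>i=1..7. z i powi n i k)"
        unfolding character_coords[OF z p[OF k]]
        by (rule prod.cong) (use z k in \<open>auto simp: nonvanishing_def n\<close>)
      then show "p k (coords z) powi m k j = (\<Prod>i=1..7. z i powi (n i k * m k j))"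
        by (simp add: power_int_prod_base power_int_mult)
    qed
    also have "\<dots> = (\<Prod>i=1..7. \<Prod>k<r. z i powi (n i k * m k j))"
      by (rule prod.swap)
    also have "\<dots> = (\<Prod>i=1..7. z i powi M i j)"
      unfolding M_def
      by (rule prod.cong) (use z in \<open>auto simp: nonvanishing_def power_int_sum_exponent\<close>)
    also have "\<dots> = (\<Prod>i=1..7. if i = j then z i else 1)"
      by (rule prod.cong) (use M assms(4) in auto)
    also have "\<dots> = z j" using assms(4) by simp
    finally show ?thesis ..
  qed
  show ?thesis using recover[OF x] recover[OF y] eq by simp
qed

end

section \<open>Negatives of roots and squares of Tits elements\<close>

lemma alg_hom_cong:
  assumes "f \<in> alg_hom A B" and "\<And>x. x \<in> carrier A \<Longrightarrow> f x = g x"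
    and "\<And>x y. x \<in> carrier A \<Longrightarrow> y \<in> carrier A \<Longrightarrow> x \<otimes>\<^bsub>A\<^esub> y \<in> carrier A"
  shows "g \<in> alg_hom A B"
proof (rule alg_homI)
  show "g \<in> hom A B"
    using alg_hom_in_hom[OF assms(1)] assms(2,3) by (auto simp: hom_def Pi_def)
next
  fix y assume "y \<in> gens B"
  from alg_hom_regular[OF assms(1) function_algebra.gen[OF this]]
  show "\<exists>q\<in>function_algebra (gens A). \<forall>x\<in>carrier A. y (g x) = q x"
    using assms(2) by (auto intro: bexI)
qed

definition conj_by :: "'f::field ^ 'n ^ 'n \<Rightarrow> 'f ^ 'n ^ 'n \<Rightarrow> 'f ^ 'n ^ 'n" where
  "conj_by s A = s ** A ** matrix_inv s"

lemma conj_by_mult: "invertible s \<Longrightarrow> conj_by s A ** conj_by s B = conj_by s (A ** B)"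
proof -
  assume s: "invertible s"
  have "conj_by s A ** conj_by s B = s ** A ** (matrix_inv s ** s) ** B ** matrix_inv s"
    by (simp only: conj_by_def matrix_mul_assoc)
  then show ?thesis by (simp add: matrix_inv_inverse[OF s] conj_by_def matrix_mul_assoc)
qed

lemma conj_by_inv [simp]:
  assumes "invertible s"
  shows "conj_by (matrix_inv s) (conj_by s A) = A" "conj_by s (conj_by (matrix_inv s) A) = A"
proof -
  have "conj_by (matrix_inv s) (conj_by s A) = (matrix_inv s ** s) ** A ** (matrix_inv s ** s)"
    by (simp only: conj_by_def matrix_mul_assoc matrix_inv_inv[OF assms])
  then show "conj_by (matrix_inv s) (conj_by s A) = A"
    by (simp add: matrix_inv_inverse[OF assms])
  have "conj_by s (conj_by (matrix_inv s) A) = (s ** matrix_inv s) ** A ** (s ** matrix_inv s)"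
    by (simp only: conj_by_def matrix_mul_assoc matrix_inv_inv[OF assms])
  then show "conj_by s (conj_by (matrix_inv s) A) = A"
    by (simp add: matrix_inv_inverse[OF assms])
qed

lemma invertible_conj_by: "invertible s \<Longrightarrow> invertible A \<Longrightarrow> invertible (conj_by s A)"
  unfolding conj_by_def by (intro invertible_mult invertible_matrix_inv)

text \<open>The entries of \<open>s A s\<^sup>-\<^sup>1\<close> are linear in those of \<open>A\<close>, and the determinant does not change.\<close>

lemma conj_by_regular:
  fixes s :: "'f::field ^ 'n ^ 'n"
  assumes s: "invertible s" and p: "p \<in> function_algebra (gens GL)"
  shows "(\<lambda>A. p (conj_by s A)) \<in> function_algebra (gens GL)"
proof -
  have entry: "(\<lambda>A. A $ i $ j) \<in> function_algebra (gens GL)"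
    for i j :: 'n by (rule function_algebra.gen) (auto simp: GL_def)
  have "(\<lambda>A. y (conj_by s A)) \<in> function_algebra (gens GL)" if "y \<in> gens GL" for y
  proof -
    consider i j where "y = (\<lambda>A. A $ i $ j)" | "y = (\<lambda>A. inverse (det A))"
      using \<open>y \<in> gens GL\<close> by (auto simp: GL_def)
    then show ?thesis
    proof cases
      case 1
      have "(\<lambda>A. \<Sum>k\<in>UNIV. (\<Sum>l\<in>UNIV. s $ i $ l * A $ l $ k) * matrix_inv s $ k $ j)
        \<in> function_algebra (gens GL)"
        by (intro function_algebra_sum function_algebra.mult function_algebra.const entry) auto
      then show ?thesis
        by (simp add: 1 conj_by_def matrix_matrix_mult_def)
    next
      case 2
      have "det s * det (matrix_inv s) = 1"
        using matrix_inv_inverse(1)[OF s] by (metis det_I det_mul)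
      then have "det (conj_by s A) = det A" for A
        by (simp add: conj_by_def det_mul)
      then show ?thesis using that by (simp add: 2 function_algebra.gen)
    qed
  qed
  then have "\<exists>q\<in>function_algebra (gens GL). \<forall>A\<in>UNIV. p (conj_by s A) = q A"
    by (intro function_algebra_compose[OF p]) auto
  then obtain q where "q \<in> function_algebra (gens GL)" "(\<lambda>A. p (conj_by s A)) = q" by auto
  then show ?thesis by simp
qed

lemma conj_by_alg_hom:
  assumes "invertible s"
  shows "conj_by s \<in> alg_hom (sub H) (sub (conj_by s ` H))"
proof (rule alg_homI)
  show "conj_by s \<in> hom (sub H) (sub (conj_by s ` H))"
    using conj_by_mult[OF assms] by (auto simp: hom_def)
next
  fix y assume "y \<in> gens (sub (conj_by s ` H))"
  then have "y \<in> function_algebra (gens GL)" by (simp add: function_algebra.gen)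
  from conj_by_regular[OF assms this]
  show "\<exists>q\<in>function_algebra (gens (sub H)). \<forall>A\<in>carrier (sub H). y (conj_by s A) = q A" by auto
qed

lemma closed_subgroup_conj_by:
  assumes s: "invertible s" and H: "closed_subgroup H"
  shows "closed_subgroup (conj_by s ` H)"
proof -
  interpret group_hom GL GL "conj_by s"
    using conj_by_mult[OF s] invertible_conj_by[OF s]
    by (auto simp: group_hom_def group_hom_axioms_def group_GL hom_def)
  have "subgroup (conj_by s ` H) GL"
    using H by (intro subgroup_img_is_subgroup) (simp add: closed_subgroup_def)
  moreover have "zariski_closed (conj_by s ` H)"
  proof -
    obtain P where P: "P \<subseteq> function_algebra (gens GL)"
      "H = {A \<in> carrier GL. \<forall>p \<in> P. p A = 0}"
      using H by (auto simp: closed_subgroup_def zariski_closed_def)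
    let ?P = "(\<lambda>p A. p (conj_by (matrix_inv s) A)) ` P"
    have "?P \<subseteq> function_algebra (gens GL)"
      using P(1) conj_by_regular[OF invertible_matrix_inv[OF s]] by blast
    moreover have "conj_by s ` H = {A \<in> carrier GL. \<forall>p \<in> ?P. p A = 0}"
    proof (intro equalityI subsetI)
      fix A assume "A \<in> {A \<in> carrier GL. \<forall>p \<in> ?P. p A = 0}"
      then have "conj_by (matrix_inv s) A \<in> H"
        using invertible_conj_by[OF invertible_matrix_inv[OF s]] by (auto simp: P(2))
      then show "A \<in> conj_by s ` H" using conj_by_inv(2)[OF s] by (metis imageI)
    qed (use s invertible_conj_by[OF s] in \<open>auto simp: P(2)\<close>)
    ultimately show ?thesis unfolding zariski_closed_def by blast
  qed
  ultimately show ?thesis by (simp add: closed_subgroup_def)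
qed

context e7_group
begin

abbreviation "N \<equiv> normalizer (sub G) T"

lemma T_normal: "T \<lhd> sub N"
proof -
  have "group (sub G)" using subgroup.subgroup_is_group[OF subgroup_G group_GL] .
  moreover have "subgroup T (sub G)"
    using group.subgroup_incl[OF group_GL subgroup_T subgroup_G T_subset_G] .
  ultimately show ?thesis using group.subgroup_in_normalizer[of "sub G" T] by simp
qed

lemma N_subset_G: "N \<subseteq> G"
  by (auto simp: normalizer_def stabilizer_def)

lemma N_invertible: "n \<in> N \<Longrightarrow> invertible n"
  using N_subset_G G_invertible by blast

lemma subgroup_N: "subgroup N GL"
proof -
  have "group (sub N)" using T_normal by (simp add: normal_def)
  then show ?thesis
    using group.group_incl_imp_subgroup[OF group_GL, of N] N_invertible by auto
qed

lemma N_mult: "m \<in> N \<Longrightarrow> n \<in> N \<Longrightarrow> m ** n \<in> N"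
  using subgroup.m_closed[OF subgroup_N] by simp

lemma N_one: "mat 1 \<in> N"
  using subgroup.one_closed[OF subgroup_N] by simp

lemma N_inv: "n \<in> N \<Longrightarrow> matrix_inv n \<in> N"
  using subgroup.m_inv_closed[OF subgroup_N] inv_GL[OF N_invertible] by metis

lemma N_normalizes: "n \<in> N \<Longrightarrow> t \<in> T \<Longrightarrow> n ** t ** matrix_inv n \<in> T"
  using normal.inv_op_closed2[OF T_normal, of n t] inv_GL[OF N_invertible]
    group.m_inv_consistent[OF group_GL subgroup_N] by simp

lemma coroot_inverse:
  assumes "\<alpha> \<in> roots G T" "c \<noteq> 0"
  shows "matrix_inv (cr \<alpha> c) = cr \<alpha> (inverse c)"
  by (rule matrix_inv_unique)
     (use coroot_mult[OF assms, of "inverse c"] assms coroot_one in simp)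

lemma root_coroot_square: "\<alpha> \<in> roots G T \<Longrightarrow> c \<noteq> 0 \<Longrightarrow> \<alpha> (cr \<alpha> c) = c\<^sup>2"
  using realization_at(1)[of \<alpha>] by (simp add: is_coroot_def)

text \<open>Write \<open>t = s t' s\<^sup>-\<^sup>1 = t' \<alpha>\<^sup>\<or>(\<alpha>(t'))\<^sup>-\<^sup>1\<close> and apply \<open>\<alpha>\<close>.\<close>

lemma root_reflected:
  assumes \<alpha>: "\<alpha> \<in> roots G T" and t: "t \<in> T"
  defines "s \<equiv> tits_element T u \<alpha>"
  shows "\<alpha> (conj_by (matrix_inv s) t) = inverse (\<alpha> t)"
proof -
  have s: "s \<in> N" unfolding s_def by (rule realization_at(3)[OF \<alpha>])
  define t' where "t' = conj_by (matrix_inv s) t"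
  have t': "t' \<in> T" unfolding t'_def conj_by_def by (rule N_normalizes[OF N_inv[OF s] t])
  have nz: "\<alpha> t' \<noteq> 0" by (rule root_nonzero[OF \<alpha> t'])
  have "t = conj_by s t'" using N_invertible[OF s] by (simp add: t'_def)
  also have "\<dots> = t' ** cr \<alpha> (inverse (\<alpha> t'))"
    using realization_at(4)[OF \<alpha>] t' coroot_inverse[OF \<alpha> nz]
    by (simp add: induces_reflection_def conj_by_def s_def)
  finally have "\<alpha> t = \<alpha> t' * (inverse (\<alpha> t'))\<^sup>2"
    using root_mult[OF \<alpha> t' coroot_in_T[OF \<alpha>]] root_coroot_square[OF \<alpha>] nz by simp
  then have "\<alpha> t = inverse (\<alpha> t')" using nz by (simp add: power2_eq_square)
  then show ?thesis by (simp add: t'_def)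
qed

lemma root_isomorphism_hom: "root_isomorphism G T \<alpha> v \<Longrightarrow> v (x + y) = v x ** v y"
  using alg_hom_mult[of v Ga "sub (range v)" x y]
  by (simp add: root_isomorphism_def alg_iso_def)

text \<open>Conjugation by \<open>\<sigma>\<^sub>\<alpha>\<close> carries the root subgroup of \<open>\<alpha>\<close> to one on which \<open>T\<close> acts through \<open>-\<alpha>\<close>.\<close>

lemma neg_root:
  assumes \<alpha>: "\<alpha> \<in> roots G T"
  shows "neg_char T \<alpha> \<in> roots G T"
proof -
  define s where "s = tits_element T u \<alpha>"
  have sN: "s \<in> N" unfolding s_def by (rule realization_at(3)[OF \<alpha>])
  then have s: "invertible s" by (rule N_invertible)
  define v where "v x = conj_by s (u \<alpha> x)" for x
  have ru: "root_isomorphism G T \<alpha> (u \<alpha>)" by (rule realization_at(2)[OF \<alpha>])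
  have range_v: "range v = conj_by s ` range (u \<alpha>)" by (auto simp: v_def)
  have u_iso: "u \<alpha> \<in> alg_hom Ga (sub (range (u \<alpha>)))" "inj (u \<alpha>)"
    "inv_into UNIV (u \<alpha>) \<in> alg_hom (sub (range (u \<alpha>))) Ga"
    using ru by (simp_all add: root_isomorphism_def alg_iso_def bij_betw_def)
  have v_hom: "v \<in> alg_hom Ga (sub (range v))"
    using alg_hom_compose[OF u_iso(1) conj_by_alg_hom[OF s]] unfolding range_v v_def .
  have inj_v: "inj v"
    using u_iso(2) conj_by_inv(1)[OF s] unfolding v_def inj_def by metis
  have "inv_into UNIV v \<in> alg_hom (sub (range v)) Ga"
  proof (rule alg_hom_cong)
    have "conj_by (matrix_inv s) ` range v = range (u \<alpha>)"
      by (simp add: range_v image_image s)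
    then show "(\<lambda>A. inv_into UNIV (u \<alpha>) (conj_by (matrix_inv s) A)) \<in> alg_hom (sub (range v)) Ga"
      using alg_hom_compose[OF conj_by_alg_hom[OF invertible_matrix_inv[OF s], of "range v"]] u_iso(3)
      by simp
    show "inv_into UNIV (u \<alpha>) (conj_by (matrix_inv s) A) = inv_into UNIV v A"
      if "A \<in> carrier (sub (range v))" for A
      using that u_iso(2) inj_v s by (auto simp: v_def inv_f_f) (simp add: v_def[symmetric] inv_f_f)
    show "A \<otimes>\<^bsub>sub (range v)\<^esub> B \<in> carrier (sub (range v))"
      if "A \<in> carrier (sub (range v))" "B \<in> carrier (sub (range v))" for A B
      using that alg_hom_mult[OF v_hom] by auto (metis rangeI)
  qed
  then have "v \<in> alg_iso Ga (sub (range v))"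
    using v_hom inj_v by (simp add: alg_iso_def bij_betw_def)
  moreover have "closed_subgroup (range v)"
    unfolding range_v using closed_subgroup_conj_by[OF s] ru by (simp add: root_isomorphism_def)
  moreover have "range v \<subseteq> G"
  proof -
    have "s \<in> G" "matrix_inv s \<in> G" using sN N_inv[OF sN] N_subset_G by auto
    moreover have "u \<alpha> x \<in> G" for x using ru by (auto simp: root_isomorphism_def)
    ultimately show ?thesis
      using subgroup.m_closed[OF subgroup_G] by (auto simp: v_def conj_by_def)
  qed
  moreover have "t ** v x ** matrix_inv t = v (neg_char T \<alpha> t * x)" if t: "t \<in> T" for t x
  proof -
    define t' where "t' = conj_by (matrix_inv s) t"
    have t': "t' \<in> T" unfolding t'_def conj_by_def by (rule N_normalizes[OF N_inv[OF sN] t])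
    have tt': "t = conj_by s t'" by (simp add: t'_def s)
    have "matrix_inv t = conj_by s (matrix_inv t')"
      by (rule matrix_inv_unique)
         (simp add: tt' conj_by_mult s matrix_inv_inverse T_invertible[OF t'], simp add: conj_by_def
           matrix_inv_inverse s)
    then have "t ** v x ** matrix_inv t = conj_by s (t' ** u \<alpha> x ** matrix_inv t')"
      by (simp add: tt' v_def conj_by_mult s)
    also have "\<dots> = v (\<alpha> t' * x)"
      using ru t' by (simp add: root_isomorphism_def v_def)
    finally show ?thesis
      using root_reflected[OF \<alpha> t] t by (simp add: t'_def s_def neg_char_def)
  qed
  ultimately have "root_isomorphism G T (neg_char T \<alpha>) v" by (simp add: root_isomorphism_def)
  moreover have "neg_char T \<alpha> \<in> characters T"
  proof -
    have "neg_char T \<alpha> \<in> alg_hom (sub T) Gm"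
    proof (rule alg_homI)
      show "neg_char T \<alpha> \<in> hom (sub T) Gm"
        using root_nonzero[OF \<alpha>] root_mult[OF \<alpha>] T_mult by (auto simp: hom_def neg_char_def)
    next
      fix y :: "'f \<Rightarrow> 'f" assume "y \<in> gens Gm"
      then have "(\<lambda>x. y (inverse x)) \<in> gens Gm" by auto
      from alg_hom_regular[OF root_hom[OF \<alpha>] function_algebra.gen[OF this]]
      show "\<exists>q\<in>function_algebra (gens (sub T)). \<forall>t\<in>carrier (sub T). y (neg_char T \<alpha> t) = q t"
        by (simp add: neg_char_def)
    qed
    then show ?thesis by (simp add: characters_def neg_char_def)
  qed
  moreover have "neg_char T \<alpha> \<noteq> (\<lambda>t\<in>T. 1)"
  proof
    assume *: "neg_char T \<alpha> = (\<lambda>t\<in>T. 1)"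
    have "\<alpha> t = 1" if "t \<in> T" for t
      using fun_cong[OF *, of t] that by (simp add: neg_char_def inverse_eq_1_iff)
    then have "\<alpha> = (\<lambda>t\<in>T. 1)"
      using \<alpha> by (auto simp: roots_def characters_def extensional_def fun_eq_iff)
    then show False using \<alpha> by (simp add: roots_def)
  qed
  ultimately show ?thesis by (auto simp: roots_def)
qed

text \<open>At \<open>x = -1\<close> the defining relation of the realization says that \<open>u\<^sub>\<alpha>(-1) u\<^sub>-\<^sub>\<alpha>(1) u\<^sub>\<alpha>(-1)\<close>, which is the
  inverse of \<open>\<sigma>\<^sub>\<alpha>\<close>, equals \<open>\<alpha>\<^sup>\<or>(-1) \<sigma>\<^sub>\<alpha>\<close>; moreover \<open>\<sigma>\<^sub>\<alpha>\<close> commutes with \<open>\<alpha>\<^sup>\<or>(-1)\<close>.\<close>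

lemma tits_element_square:
  assumes \<alpha>: "\<alpha> \<in> roots G T"
  defines "s \<equiv> tits_element T u \<alpha>"
  shows "s ** s = cr \<alpha> (- 1)"
proof -
  have inv_mult: "v x ** v (- x) = mat 1" if "root_isomorphism G T \<beta> v" for \<beta> v and x :: 'f
  proof -
    have "v 0 ** v 0 = v 0" using root_isomorphism_hom[OF that, of 0 0] by simp
    moreover have "invertible (v 0)"
      using that G_invertible by (auto simp: root_isomorphism_def)
    ultimately have "v 0 = mat 1" by (metis matrix_inv_inverse(2) matrix_mul_assoc matrix_mul_lid)
    then show ?thesis using root_isomorphism_hom[OF that, of x "- x"] by simp
  qed
  note u = inv_mult[OF realization_at(2)[OF \<alpha>], of 1]
    and v = inv_mult[OF realization_at(2)[OF neg_root[OF \<alpha>]], of "- 1"]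
  let ?c = "cr \<alpha> (- 1)"
  have s: "s \<in> N" unfolding s_def by (rule realization_at(3)[OF \<alpha>])
  have c: "?c \<in> T" by (rule coroot_in_T[OF \<alpha>]) simp
  have "s ** (?c ** s) = s ** (u \<alpha> (- 1) ** u (neg_char T \<alpha>) 1 ** u \<alpha> (- 1))"
    using realization_at(5)[OF \<alpha>, of "- 1"] by (simp add: s_def)
  also have "\<dots> = u \<alpha> 1 ** (u (neg_char T \<alpha>) (- 1) ** (u \<alpha> 1 ** u \<alpha> (- 1)) ** u (neg_char T \<alpha>) 1)
      ** u \<alpha> (- 1)"
    by (simp only: s_def tits_element_def matrix_mul_assoc)
  also have "\<dots> = mat 1" using u v by simp
  finally have *: "s ** (?c ** s) = mat 1" .
  have "s ** ?c ** matrix_inv s = ?c"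
    using realization_at(4)[OF \<alpha>] c root_coroot_square[OF \<alpha>, of "- 1"] coroot_one[OF \<alpha>]
      matrix_inv_unique[of "mat 1 :: 'f ^ 'n ^ 'n" "mat 1"]
    by (simp add: induces_reflection_def s_def)
  then have "s ** ?c = ?c ** s"
    using matrix_inv_inverse(2)[OF N_invertible[OF s]]
    by (metis matrix_mul_assoc matrix_mul_rid)
  then have "?c ** (s ** s) = mat 1" using * by (simp add: matrix_mul_assoc)
  then have "matrix_inv ?c = s ** s" by (rule matrix_inv_unique)
  moreover have "matrix_inv ?c = ?c" using coroot_inverse[OF \<alpha>, of "- 1"] by simp
  ultimately show ?thesis by simp
qed

end

section \<open>Words in the simple reflections\<close>

lemma word_prod_simps [simp]:
  "word_prod M s [] = \<one>\<^bsub>M\<^esub>" "word_prod M s (i # is) = s i \<otimes>\<^bsub>M\<^esub> word_prod M s is"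
  by (simp_all add: word_prod_def)

context e7_group
begin

abbreviation "W \<equiv> weyl_group G T"
abbreviation "\<sigma> i \<equiv> tits_element T u (a i)"
abbreviation "srefl i \<equiv> simple_reflection T u a i"

lemma \<sigma>_in_N: "i \<in> {1..7} \<Longrightarrow> \<sigma> i \<in> N"
  by (rule realization_at(3)[OF simple_root])

lemma \<sigma>_coords:
  assumes "i \<in> {1..7}" and x: "nonvanishing x"
  shows "\<sigma> i ** coords x = coords (reflect i x) ** \<sigma> i"
proof -
  have nz: "root_value x i \<noteq> 0" by (rule root_value_nonzero[OF x])
  have "\<sigma> i ** coords x ** matrix_inv (\<sigma> i) = coords x ** matrix_inv (cr (a i) (root_value x i))"
    using realization_at(4)[OF simple_root[OF assms(1)]] coords_in_T[OF x]
      root_coords[OF x assms(1)] by (simp add: induces_reflection_def)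
  also have "\<dots> = coords x ** coords ((\<lambda>_. 1)(i := inverse (root_value x i)))"
    using coroot_inverse[OF simple_root[OF assms(1)] nz]
      coroot_eq_coords[OF assms(1), of "inverse (root_value x i)"] nz by simp
  also have "\<dots> = coords (\<lambda>j. x j * ((\<lambda>_. 1)(i := inverse (root_value x i))) j)"
    by (rule coords_mult[OF x]) (use nz in \<open>simp add: nonvanishing_def\<close>)
  also have "\<dots> = coords (reflect i x)"
    by (rule coords_cong) (auto simp: reflect_def divide_inverse)
  finally have "\<sigma> i ** coords x ** (matrix_inv (\<sigma> i) ** \<sigma> i) = coords (reflect i x) ** \<sigma> i"
    by (simp only: matrix_mul_assoc)
  then show ?thesis using matrix_inv_inverse(2)[OF N_invertible[OF \<sigma>_in_N[OF assms(1)]]] by simp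
qed

lemma word_\<sigma>_in_N: "set is \<subseteq> {1..7} \<Longrightarrow> word_prod GL \<sigma> is \<in> N"
proof (induction "is")
  case (Cons i "is")
  then show ?case using N_mult[OF \<sigma>_in_N] by simp
qed (simp add: N_one)

lemma word_\<sigma>_coords:
  assumes "set is \<subseteq> {1..7}" "nonvanishing x"
  shows "word_prod GL \<sigma> is ** coords x = coords (foldr reflect is x) ** word_prod GL \<sigma> is"
  using assms(1)
proof (induction "is")
  case (Cons i "is")
  have i: "i \<in> {1..7}" using Cons.prems by simp
  have "word_prod GL \<sigma> (i # is) ** coords x = \<sigma> i ** (word_prod GL \<sigma> is ** coords x)"
    by (simp add: matrix_mul_assoc)
  also have "\<dots> = (\<sigma> i ** coords (foldr reflect is x)) ** word_prod GL \<sigma> is"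
    using Cons by (simp add: matrix_mul_assoc)
  also have "\<dots> = coords (foldr reflect (i # is) x) ** word_prod GL \<sigma> (i # is)"
    using \<sigma>_coords[OF i nonvanishing_foldr_reflect[OF assms(2)]] by (simp add: matrix_mul_assoc)
  finally show ?case .
qed simp

lemma weyl_proj_eq: "weyl_proj T n = (\<lambda>t. t ** n) ` T"
  by (auto simp: weyl_proj_def r_coset_def)

lemma carrier_W: "carrier W = weyl_proj T ` N"
  by (auto simp: weyl_group_def FactGroup_def RCOSETS_def weyl_proj_def r_coset_def)

lemma weyl_proj_mult:
  assumes "m \<in> N" "n \<in> N"
  shows "weyl_proj T m \<otimes>\<^bsub>W\<^esub> weyl_proj T n = weyl_proj T (m ** n)"
  using normal.rcos_sum[OF T_normal, of m n] assms
  by (simp add: weyl_group_def FactGroup_def weyl_proj_def r_coset_def set_mult_def)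

lemma weyl_proj_one: "weyl_proj T (mat 1) = \<one>\<^bsub>W\<^esub>"
  by (auto simp: weyl_proj_eq weyl_group_def FactGroup_def)

lemma word_prod_weyl_proj:
  assumes "\<And>i. i \<in> {1..7} \<Longrightarrow> g i \<in> N \<and> weyl_proj T (g i) = srefl i" "set is \<subseteq> {1..7}"
  shows "word_prod GL g is \<in> N \<and> weyl_proj T (word_prod GL g is) = word_prod W srefl is"
  using assms(2)
proof (induction "is")
  case Nil
  then show ?case by (simp add: N_one weyl_proj_one)
next
  case (Cons i "is")
  then have *: "g i \<in> N" "weyl_proj T (g i) = srefl i" "word_prod GL g is \<in> N"
    "weyl_proj T (word_prod GL g is) = word_prod W srefl is" using assms(1)[of i] by auto
  then show ?case using N_mult weyl_proj_mult[OF *(1,3)] by simp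
qed

lemma word_prod_W: "set is \<subseteq> {1..7} \<Longrightarrow> word_prod W srefl is = weyl_proj T (word_prod GL \<sigma> is)"
  using word_prod_weyl_proj[of \<sigma> "is"] \<sigma>_in_N by (simp add: simple_reflection_def)

lemma weyl_proj_eqD: "weyl_proj T m = weyl_proj T n \<Longrightarrow> \<exists>t\<in>T. m = t ** n"
  using T_one unfolding weyl_proj_eq by (metis (no_types, lifting) image_iff matrix_mul_lid)

lemma weyl_proj_eqI:
  assumes "n \<in> N" "t \<in> T"
  shows "weyl_proj T (t ** n) = weyl_proj T n"
proof
  show "weyl_proj T (t ** n) \<subseteq> weyl_proj T n"
    using T_mult[OF _ assms(2)] by (auto simp: weyl_proj_eq matrix_mul_assoc)
  show "weyl_proj T n \<subseteq> weyl_proj T (t ** n)"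
  proof
    fix m assume "m \<in> weyl_proj T n"
    then obtain s where s: "s \<in> T" "m = s ** n" by (auto simp: weyl_proj_eq)
    have "m = s ** (matrix_inv t ** t) ** n"
      using s(2) by (simp add: matrix_inv_inverse T_invertible[OF assms(2)])
    then have "m = (s ** matrix_inv t) ** (t ** n)" by (simp only: matrix_mul_assoc)
    then show "m \<in> weyl_proj T (t ** n)"
      unfolding weyl_proj_eq using T_mult[OF s(1) T_inv[OF assms(2)]] by (rule image_eqI)
  qed
qed

text \<open>If two words act in the same way on coordinates, the quotient of the corresponding products of
  Tits elements centralizes \<open>T\<close>, and \<open>T\<close> is its own centralizer.  The converse uses that
  coordinates are unique.\<close>

lemma words_equal_iff:
  assumes I: "set is \<subseteq> {1..7}" and J: "set js \<subseteq> {1..7}"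
  shows "word_prod W srefl is = word_prod W srefl js \<longleftrightarrow>
    (\<forall>x :: nat \<Rightarrow> 'f. nonvanishing x \<longrightarrow> (\<forall>k\<in>{1..7}. foldr reflect is x k = foldr reflect js x k))"
proof
  let ?m = "word_prod GL \<sigma> is" and ?n = "word_prod GL \<sigma> js"
  have mN: "?m \<in> N" and nN: "?n \<in> N" using word_\<sigma>_in_N I J by auto
  note m_inv = N_invertible[OF mN] and n_inv = N_invertible[OF nN]
  {
    assume "word_prod W srefl is = word_prod W srefl js"
    then obtain t where t: "t \<in> T" "?m = t ** ?n"
      using weyl_proj_eqD[of ?m ?n] I J by (auto simp: word_prod_W)
    show "\<forall>x :: nat \<Rightarrow> 'f. nonvanishing x \<longrightarrow> (\<forall>k\<in>{1..7}. foldr reflect is x k = foldr reflect js x k)"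
    proof (intro allI impI)
      fix x :: "nat \<Rightarrow> 'f" assume x: "nonvanishing x"
      note ix = nonvanishing_foldr_reflect[OF x, of "is"] and jx = nonvanishing_foldr_reflect[OF x, of js]
      have "coords (foldr reflect is x) ** ?m = t ** (?n ** coords x)"
        using word_\<sigma>_coords[OF I x] t(2) by (simp add: matrix_mul_assoc)
      also have "\<dots> = (t ** coords (foldr reflect js x)) ** ?n"
        using word_\<sigma>_coords[OF J x] by (simp add: matrix_mul_assoc)
      also have "\<dots> = coords (foldr reflect js x) ** ?m"
        using T_commute[OF t(1) coords_in_T[OF jx]] t(2) by (simp add: matrix_mul_assoc)
      finally have "coords (foldr reflect is x) = coords (foldr reflect js x)"
        by (rule matrix_cancel_right[OF m_inv])
      then show "\<forall>k\<in>{1..7}. foldr reflect is x k = foldr reflect js x k"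
        using coords_inj[OF ix jx] by blast
    qed
  }
  assume eq: "\<forall>x :: nat \<Rightarrow> 'f. nonvanishing x \<longrightarrow> (\<forall>k\<in>{1..7}. foldr reflect is x k = foldr reflect js x k)"
  define g where "g = ?m ** matrix_inv ?n"
  have gn: "g ** ?n = ?m"
    using matrix_inv_inverse(2)[OF n_inv] by (simp add: g_def flip: matrix_mul_assoc)
  have "g ** t = t ** g" if "t \<in> T" for t
  proof -
    obtain x where x: "nonvanishing x" "matrix_inv ?n ** t ** ?n = coords x"
      using N_normalizes[OF N_inv[OF nN] \<open>t \<in> T\<close>] coords_surj matrix_inv_inv[OF n_inv] by metis
    have "coords (foldr reflect js x) ** ?n = (?n ** matrix_inv ?n) ** t ** ?n"
      using word_\<sigma>_coords[OF J x(1)] by (simp add: matrix_mul_assoc flip: x(2))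
    then have "coords (foldr reflect js x) ** ?n = t ** ?n"
      by (simp add: matrix_inv_inverse(1)[OF n_inv])
    then have "coords (foldr reflect js x) = t" by (rule matrix_cancel_right[OF n_inv])
    moreover have "coords (foldr reflect is x) = coords (foldr reflect js x)"
      by (rule coords_cong) (use eq x(1) in blast)
    ultimately have t: "coords (foldr reflect is x) = t" by simp
    have "g ** t = ?m ** matrix_inv ?n ** t ** (?n ** matrix_inv ?n)"
      by (simp add: g_def matrix_inv_inverse(1)[OF n_inv])
    also have "\<dots> = ?m ** (matrix_inv ?n ** t ** ?n) ** matrix_inv ?n"
      by (simp only: matrix_mul_assoc)
    also have "\<dots> = t ** g"
      using word_\<sigma>_coords[OF I x(1)] t by (simp add: x(2) g_def matrix_mul_assoc)
    finally show ?thesis .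
  qed
  moreover have "g \<in> G" using N_mult[OF mN N_inv[OF nN]] N_subset_G by (auto simp: g_def)
  ultimately have "g \<in> T"
    using setting by (auto simp: simply_connected_E7_setting_def weyl_group_of_roots_def)
  then show "word_prod W srefl is = word_prod W srefl js"
    using weyl_proj_eqI[OF nN \<open>g \<in> T\<close>] by (simp only: gn word_prod_W[OF I] word_prod_W[OF J])
qed


lemma commuting_words:
  assumes "i \<in> {1..7}" "j \<in> {1..7}" "i \<noteq> j" "\<not> e7_adjacent i j"
  shows "word_prod W srefl [i, j] = word_prod W srefl [j, i]"
proof (subst words_equal_iff; (intro allI impI ballI)?)
  fix x :: "nat \<Rightarrow> 'f" and k :: nat assume x: "nonvanishing x"
  have "\<not> e7_adjacent j i" using assms(4) e7_adjacentD by blast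
  then show "foldr reflect [i, j] x k = foldr reflect [j, i] x k"
    using reflect_two[OF assms(1-3) x] reflect_two[OF assms(2,1) _ x] assms
      foldr_reflect_other[of k "[i, j]" x] foldr_reflect_other[of k "[j, i]" x]
    by (cases "k = i"; cases "k = j") (simp_all del: foldr.simps)
qed (use assms in auto)

lemma braid_words:
  assumes "e7_adjacent i j"
  shows "word_prod W srefl [i, j, i] = word_prod W srefl [j, i, j]"
proof (subst words_equal_iff; (intro allI impI ballI)?)
  fix x :: "nat \<Rightarrow> 'f" and k :: nat assume x: "nonvanishing x"
  have ji: "e7_adjacent j i" "i \<noteq> j" using assms e7_adjacentD by blast+
  then show "foldr reflect [i, j, i] x k = foldr reflect [j, i, j] x k"
    using reflect_three[OF assms(1) x] reflect_three[OF ji(1) x]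
      foldr_reflect_other[of k "[i, j, i]" x] foldr_reflect_other[of k "[j, i, j]" x]
    by (cases "k = i"; cases "k = j") (simp_all del: foldr.simps add: mult.commute)
qed (use e7_adjacentD[OF assms] in auto)

text \<open>A common value \<open>c\<close> of the simple roots with \<open>c\<^sup>2 \<noteq> 1\<close> is enough to separate the words
  \<open>s\<^sub>i s\<^sub>j\<close> and \<open>s\<^sub>i s\<^sub>j s\<^sub>i\<close> below from shorter ones.\<close>

lemma regular_point:
  obtains x :: "nat \<Rightarrow> 'f" and c :: 'f
  where "nonvanishing x" "c \<noteq> 0" "c \<noteq> 1" "c\<^sup>2 \<noteq> 1" "\<forall>l\<in>{1..7}. root_value x l = c"
proof -
  obtain c :: 'f where "c \<notin> {0, 1, - 1}"
    using ex_new_if_finite[OF infinite_UNIV_alg_closed, of "{0, 1, - 1 :: 'f}"] by blast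
  then have c: "c \<noteq> 0" "c \<noteq> 1" "c\<^sup>2 \<noteq> 1" by (auto simp: power2_eq_1_iff)
  obtain x :: "nat \<Rightarrow> 'f" where "nonvanishing x" "\<forall>l\<in>{1..7}. root_value x l = c"
    using root_value_surj[of "\<lambda>_. c"] c(1) by (auto simp: nonvanishing_def)
  then show ?thesis using that c by blast
qed

text \<open>A shorter word leaves the coordinate \<open>i\<close> or the coordinate \<open>j\<close> fixed, but \<open>s\<^sub>i s\<^sub>j\<close> changes both at a
  regular point.\<close>

lemma reduced_two:
  assumes ij: "i \<in> {1..7}" "j \<in> {1..7}" "i \<noteq> j"
  shows "reduced_word G T u a [i, j]"
proof (rule ccontr)
  assume "\<not> reduced_word G T u a [i, j]"
  then obtain js where js: "set js \<subseteq> {1..7}" "word_prod W srefl js = word_prod W srefl [i, j]"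
    "length js < 2" using ij by (auto simp: reduced_word_def)
  obtain x :: "nat \<Rightarrow> 'f" and c where x: "nonvanishing x" and c: "c \<noteq> 0" "c \<noteq> 1" "c\<^sup>2 \<noteq> 1"
    and rv: "\<forall>l\<in>{1..7}. root_value x l = c" by (rule regular_point)
  have eq: "foldr reflect js x k = foldr reflect [i, j] x k" if "k \<in> {1..7}" for k
    using js ij x that words_equal_iff[of js "[i, j]"] by auto
  have nz: "x i \<noteq> 0" "x j \<noteq> 0" using x ij by (auto simp: nonvanishing_def)
  have "i \<notin> set js \<or> j \<notin> set js" using js(3) ij(3) by (cases js) auto
  then show False
  proof
    assume "i \<notin> set js"
    then have "x i = x i / (c * c powi (- e7_cartan j i))"
      using eq[OF ij(1)] reflect_two(2)[OF ij x] foldr_reflect_other[of i js x] rv ij by simp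
    moreover have "c * c powi (- e7_cartan j i) \<in> {c, c\<^sup>2}"
      using ij(3) c by (cases "e7_adjacent j i") (auto simp: power2_eq_square)
    ultimately show False using nz c by (auto simp: eq_divide_eq)
  next
    assume "j \<notin> set js"
    then have "x j = x j / c"
      using eq[OF ij(2)] reflect_two(1)[OF ij x] foldr_reflect_other[of j js x] rv ij by simp
    then show False using nz c by (simp add: eq_divide_eq)
  qed
qed

text \<open>The word \<open>s\<^sub>i s\<^sub>j s\<^sub>i\<close> divides the coordinates \<open>i\<close> and \<open>j\<close> of a regular point by \<open>c\<^sup>2\<close>.  A shorter word
  that changes both coordinates is \<open>s\<^sub>i s\<^sub>j\<close> or \<open>s\<^sub>j s\<^sub>i\<close>, and it divides one of them by \<open>c\<close> only.\<close>

lemma reduced_three: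
  assumes adj: "e7_adjacent i j"
  shows "reduced_word G T u a [i, j, i]"
proof (rule ccontr)
  have ij: "i \<in> {1..7}" "j \<in> {1..7}" "i \<noteq> j" and ji: "j \<noteq> i" using e7_adjacentD[OF adj] by auto
  assume "\<not> reduced_word G T u a [i, j, i]"
  then obtain js where js: "set js \<subseteq> {1..7}" "word_prod W srefl js = word_prod W srefl [i, j, i]"
    "length js < 3" using ij by (auto simp: reduced_word_def)
  obtain x :: "nat \<Rightarrow> 'f" and c where x: "nonvanishing x" and c: "c \<noteq> 0" "c \<noteq> 1" "c\<^sup>2 \<noteq> 1"
    and rv: "\<forall>l\<in>{1..7}. root_value x l = c" by (rule regular_point)
  have nz: "x i \<noteq> 0" "x j \<noteq> 0" using x ij by (auto simp: nonvanishing_def)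
  have "foldr reflect js x k = foldr reflect [i, j, i] x k" if "k \<in> {1..7}" for k
    using js ij x that words_equal_iff[of js "[i, j, i]"] by auto
  then have eq: "foldr reflect js x i = x i / c\<^sup>2" "foldr reflect js x j = x j / c\<^sup>2"
    using reflect_three[OF adj x] ij rv by (simp_all add: power2_eq_square del: foldr.simps)
  have fixed: "foldr reflect js x k \<noteq> x k / c\<^sup>2" if "k \<notin> set js" "x k \<noteq> 0" for k
    using foldr_reflect_other[OF that(1), of x] that(2) c by (simp add: eq_divide_eq)
  have "i \<in> set js" "j \<in> set js" using eq fixed nz by auto
  then have "js = [i, j] \<or> js = [j, i]"
    using js(3) ij(3) by (cases js rule: remdups_adj.cases) auto
  then have "x j / c\<^sup>2 = x j / c \<or> x i / c\<^sup>2 = x i / c"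
    using eq reflect_two(1)[OF ij x] reflect_two(1)[OF ij(2,1) ji x] rv ij
    by (auto simp del: foldr.simps)
  then have "c\<^sup>2 = c" using nz c by (auto simp: frac_eq_eq)
  then show False using c by (simp add: power2_eq_square)
qed

section \<open>The braid relations of a section\<close>

lemma srefl_in_W: "i \<in> {1..7} \<Longrightarrow> srefl i \<in> carrier W"
  using \<sigma>_in_N by (auto simp: carrier_W simple_reflection_def)

lemma section_in_N:
  assumes "is_section G T u a S" "i \<in> {1..7}"
  shows "S (srefl i) \<in> N" "weyl_proj T (S (srefl i)) = srefl i"
  using assms srefl_in_W by (auto simp: is_section_def)

lemma section_word:
  assumes "is_section G T u a S" "reduced_word G T u a is"
  shows "S (word_prod W srefl is) = word_prod GL (\<lambda>i. S (srefl i)) is"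
  using assms by (simp add: is_section_def)

lemma section_coordinates:
  assumes "is_section G T u a S"
  obtains Y where "\<forall>i\<in>{1..7}. nonvanishing (Y i) \<and> S (srefl i) = coords (Y i) ** \<sigma> i"
proof -
  have "\<exists>y. nonvanishing y \<and> S (srefl i) = coords y ** \<sigma> i" if i: "i \<in> {1..7}" for i
  proof -
    have "weyl_proj T (S (srefl i)) = weyl_proj T (\<sigma> i)"
      using section_in_N(2)[OF assms i] by (simp add: simple_reflection_def)
    then obtain t where "t \<in> T" "S (srefl i) = t ** \<sigma> i" using weyl_proj_eqD by blast
    then show ?thesis using coords_surj by blast
  qed
  then have "\<forall>i. \<exists>y. i \<in> {1..7} \<longrightarrow> nonvanishing y \<and> S (srefl i) = coords y ** \<sigma> i" by blast
  from choice[OF this] show ?thesis using that by blast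
qed

lemma word_prod_coordinates:
  assumes "\<forall>i\<in>{1..7}. nonvanishing (Y i) \<and> g i = coords (Y i) ** \<sigma> i" "set is \<subseteq> {1..7}"
  shows "nonvanishing (foldr (twisted_reflect Y) is (\<lambda>_. 1)) \<and>
    word_prod GL g is = coords (foldr (twisted_reflect Y) is (\<lambda>_. 1)) ** word_prod GL \<sigma> is"
  using assms(2)
proof (induction "is")
  case Nil
  then show ?case by (simp add: coords_one nonvanishing_def)
next
  case (Cons i "is")
  let ?z = "foldr (twisted_reflect Y) is (\<lambda>_. 1)" and ?w = "word_prod GL \<sigma> is"
  have i: "i \<in> {1..7}" and z: "nonvanishing ?z" and IH: "word_prod GL g is = coords ?z ** ?w"
    using Cons by auto
  have y: "nonvanishing (Y i)" and gi: "g i = coords (Y i) ** \<sigma> i" using assms(1) i by auto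
  have "word_prod GL g (i # is) = coords (Y i) ** (\<sigma> i ** coords ?z) ** ?w"
    by (simp add: gi IH matrix_mul_assoc)
  also have "\<dots> = (coords (Y i) ** coords (reflect i ?z)) ** (\<sigma> i ** ?w)"
    by (simp add: \<sigma>_coords[OF i z] matrix_mul_assoc)
  also have "\<dots> = coords (foldr (twisted_reflect Y) (i # is) (\<lambda>_. 1)) ** word_prod GL \<sigma> (i # is)"
    by (simp add: coords_mult[OF y nonvanishing_reflect[OF z]] twisted_reflect_def[of Y i])
  finally show ?case
    using nonvanishing_mult[OF y nonvanishing_reflect[OF z, of i]]
    by (simp add: twisted_reflect_def[of Y i])
qed

text \<open>The relation holds for \<open>S\<close> and for the Tits section; cancelling the products of Tits elements leaves
  an equality in \<open>T\<close>, hence of coordinates.\<close>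

lemma section_relation:
  assumes Y: "\<forall>i\<in>{1..7}. nonvanishing (Y i) \<and> S (srefl i) = coords (Y i) ** \<sigma> i"
    and S: "is_section G T u a S" and N0: "is_tits_section G T u a N0"
    and red: "reduced_word G T u a is" "reduced_word G T u a js"
    and eq: "word_prod W srefl is = word_prod W srefl js" and k: "k \<in> {1..7}"
  shows "foldr (twisted_reflect Y) is (\<lambda>_. 1) k = foldr (twisted_reflect Y) js (\<lambda>_. 1) k"
proof -
  have sub: "set is \<subseteq> {1..7}" "set js \<subseteq> {1..7}" using red by (auto simp: reduced_word_def)
  have \<sigma>_word: "word_prod GL (\<lambda>i. N0 (srefl i)) ks = word_prod GL \<sigma> ks" if "set ks \<subseteq> {1..7}" for ks
    using that N0 by (induction ks) (auto simp: is_tits_section_def)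
  have "is_section G T u a N0" using N0 by (simp add: is_tits_section_def)
  then have \<sigma>_eq: "word_prod GL \<sigma> is = word_prod GL \<sigma> js"
    using section_word red eq \<sigma>_word sub by metis
  have S_eq: "word_prod GL (\<lambda>i. S (srefl i)) is = word_prod GL (\<lambda>i. S (srefl i)) js"
    using section_word[OF S red(1)] section_word[OF S red(2)] eq by simp
  note i = word_prod_coordinates[of Y "\<lambda>i. S (srefl i)", OF Y sub(1)]
    and j = word_prod_coordinates[of Y "\<lambda>i. S (srefl i)", OF Y sub(2)]
  have "coords (foldr (twisted_reflect Y) is (\<lambda>_. 1)) = coords (foldr (twisted_reflect Y) js (\<lambda>_. 1))"
    by (rule matrix_cancel_right[OF N_invertible[OF word_\<sigma>_in_N[OF sub(2)]]])
       (use i j S_eq \<sigma>_eq in simp)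
  then show ?thesis using coords_inj i j k by blast
qed

text \<open>The \<open>i\<close>-th coordinate of \<open>t\<^sub>i s\<^sub>i(t\<^sub>j) = t\<^sub>j s\<^sub>j(t\<^sub>i)\<close>.\<close>

lemma section_commuting_equation:
  assumes Y: "\<forall>i\<in>{1..7}. nonvanishing (Y i) \<and> S (srefl i) = coords (Y i) ** \<sigma> i"
    and S: "is_section G T u a S" and N0: "is_tits_section G T u a N0"
    and ij: "i \<in> {1..7}" "j \<in> {1..7}" "i \<noteq> j" "\<not> e7_adjacent i j"
  shows "root_value (Y j) i = 1"
proof -
  have "foldr (twisted_reflect Y) [i, j] (\<lambda>_. 1) i = foldr (twisted_reflect Y) [j, i] (\<lambda>_. 1) i"
    using ij by (intro section_relation[OF Y S N0] reduced_two commuting_words) auto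
  then have "Y i i * (Y j i / root_value (Y j) i) = Y j i * Y i i"
    using ij by (simp add: twisted_reflect_def reflect_one)
  moreover have "Y i i \<noteq> 0" "Y j i \<noteq> 0" "root_value (Y j) i \<noteq> 0"
    using Y ij root_value_nonzero[of "Y j" i] by (auto simp: nonvanishing_def)
  ultimately show ?thesis by (simp add: field_simps)
qed

text \<open>The coordinates outside \<open>i\<close> and \<open>j\<close>, and the \<open>i\<close>-th coordinate, of
  \<open>t\<^sub>i s\<^sub>i(t\<^sub>j) s\<^sub>i s\<^sub>j(t\<^sub>i) = t\<^sub>j s\<^sub>j(t\<^sub>i) s\<^sub>j s\<^sub>i(t\<^sub>j)\<close>.\<close>

lemma section_braid_equation:
  assumes Y: "\<forall>i\<in>{1..7}. nonvanishing (Y i) \<and> S (srefl i) = coords (Y i) ** \<sigma> i"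
    and S: "is_section G T u a S" and N0: "is_tits_section G T u a N0"
    and adj: "e7_adjacent i j"
  shows "k \<in> {1..7} \<Longrightarrow> k \<noteq> i \<Longrightarrow> k \<noteq> j \<Longrightarrow> Y i k = Y j k"
    and "Y i i = Y j i * root_value (Y i) i * root_value (Y i) j"
proof -
  have ij: "i \<in> {1..7}" "j \<in> {1..7}" "i \<noteq> j" "e7_adjacent j i" using e7_adjacentD[OF adj] by auto
  have Yi: "nonvanishing (Y i)" and Yj: "nonvanishing (Y j)" using Y ij by auto
  have rel: "foldr (twisted_reflect Y) [i, j, i] (\<lambda>_. 1) k = foldr (twisted_reflect Y) [j, i, j] (\<lambda>_. 1) k"
    if "k \<in> {1..7}" for k
    using that adj ij by (intro section_relation[OF Y S N0] reduced_three braid_words) auto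
  show "Y i k = Y j k" if "k \<in> {1..7}" "k \<noteq> i" "k \<noteq> j"
    using rel[OF that(1)] that Yi Yj by (auto simp: twisted_reflect_def nonvanishing_def)
  have nz: "Y i i \<noteq> 0" "Y j i \<noteq> 0" "root_value (Y j) i \<noteq> 0" "root_value (Y i) i \<noteq> 0"
    "root_value (Y i) j \<noteq> 0"
    using Yi Yj ij root_value_nonzero[OF Yi] root_value_nonzero[OF Yj] by (auto simp: nonvanishing_def)
  have "root_value (\<lambda>k. Y j k * reflect j (Y i) k) i =
      root_value (Y j) i * (root_value (Y i) i * root_value (Y i) j)"
    using ij Yi by (simp add: root_value_mult root_value_reflect)
  then have "Y i i * (Y j i * Y i i / (root_value (Y j) i * (root_value (Y i) i * root_value (Y i) j)))
      = Y j i * (Y i i * (Y j i / root_value (Y j) i))"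
    using rel[OF ij(1)] ij by (simp add: twisted_reflect_def reflect_one)
  then show "Y i i = Y j i * root_value (Y i) i * root_value (Y i) j"
    using nz by (simp add: field_simps)
qed

lemma section_parameter_iff:
  "section_parameter T cr u a S x \<longleftrightarrow> x\<^sup>2 = 1 \<and>
    (\<forall>i\<in>{1..7}. \<exists>y. y \<noteq> 0 \<and> S (srefl i) = coords (parameter_coords x i y) ** \<sigma> i)"
  by (simp only: section_parameter_def parameter_coords_def)

lemma section_parameter_exists:
  assumes S: "is_section G T u a S" and N0: "is_tits_section G T u a N0"
  shows "\<exists>x. section_parameter T cr u a S x"
proof -
  obtain Y where Y: "\<forall>i\<in>{1..7}. nonvanishing (Y i) \<and> S (srefl i) = coords (Y i) ** \<sigma> i"
    by (rule section_coordinates[OF S])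
  obtain x where x: "x\<^sup>2 = 1"
    "\<forall>i\<in>{1..7}. \<forall>k\<in>{1..7}. k \<noteq> i \<longrightarrow> Y i k = (if k \<in> {2, 5, 7} then x else 1)"
  proof (rule e7_section_equations[of Y])
    show "nonvanishing (Y i)" if "i \<in> {1..7}" for i using Y that by blast
  qed (use section_commuting_equation[OF Y S N0] section_braid_equation[OF Y S N0] in auto)
  have "\<exists>y. y \<noteq> 0 \<and> S (srefl i) = coords (parameter_coords x i y) ** \<sigma> i"
    if i: "i \<in> {1..7}" for i
  proof (intro exI conjI)
    show "Y i i \<noteq> 0" using Y i by (auto simp: nonvanishing_def)
    have "coords (Y i) = coords (parameter_coords x i (Y i i))"
      by (rule coords_cong) (use x(2) i in \<open>auto simp: parameter_coords_def\<close>)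
    then show "S (srefl i) = coords (parameter_coords x i (Y i i)) ** \<sigma> i"
      using Y i by simp
  qed
  then show ?thesis unfolding section_parameter_iff using x(1) by blast
qed


section \<open>Order profiles\<close>

lemma section_square:
  assumes "section_parameter T cr u a S x" "i \<in> {1..7}"
  shows "S (srefl i) ** S (srefl i) = cr (a i) (- 1)"
proof -
  obtain y where y: "y \<noteq> 0" "S (srefl i) = coords (parameter_coords x i y) ** \<sigma> i" and x: "x\<^sup>2 = 1"
    using assms unfolding section_parameter_iff by blast
  let ?p = "parameter_coords x i y"
  have p: "nonvanishing ?p" using nonvanishing_parameter_coords[OF x y(1)] .
  have "S (srefl i) ** S (srefl i) = coords ?p ** (\<sigma> i ** coords ?p) ** \<sigma> i"
    by (simp add: y(2) matrix_mul_assoc)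
  also have "\<dots> = (coords ?p ** coords (reflect i ?p)) ** (\<sigma> i ** \<sigma> i)"
    by (simp add: \<sigma>_coords[OF assms(2) p] matrix_mul_assoc)
  also have "coords ?p ** coords (reflect i ?p) = coords (\<lambda>_. 1)"
    unfolding coords_mult[OF p nonvanishing_reflect[OF p]]
    by (rule coords_cong) (rule parameter_coords_reflect[OF x y(1) assms(2)])
  finally show ?thesis
    by (simp add: coords_one tits_element_square[OF simple_root[OF assms(2)]])
qed

text \<open>A simple root adjacent to \<open>\<alpha>\<^sub>i\<close> has the value \<open>-1\<close> there.\<close>

lemma coroot_minus_one:
  assumes "(2::'f) \<noteq> 0" "i \<in> {1..7}"
  shows "cr (a i) (- 1) \<noteq> mat 1"
proof
  assume *: "cr (a i) (- 1) = mat 1"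
  have "\<exists>j. e7_adjacent i j" using assms(2) unfolding one_to_seven e7_adjacent_iff by auto
  then obtain j where j: "e7_adjacent i j" ..
  then have "j \<in> {1..7}" using e7_adjacentD by blast
  then have "a j (cr (a i) (- 1)) = - 1"
    using root_coroot[OF assms(2), of j "- 1"] j by (simp add: power_int_minus)
  then have "(1::'f) = - 1" using * root_one[OF simple_root] \<open>j \<in> {1..7}\<close> by simp
  then have "(1::'f) + 1 = 0" by (metis add.right_inverse)
  then show False using assms(1) by simp
qed

lemma section_not_in_T:
  assumes "is_section G T u a S" "i \<in> {1..7}"
  shows "S (srefl i) \<notin> T"
proof
  assume "S (srefl i) \<in> T"
  from weyl_proj_eqI[OF N_one this] have "srefl i = weyl_proj T (mat 1)"
    using section_in_N(2)[OF assms] by simp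
  then have "word_prod W srefl [i] = word_prod W srefl []"
    using word_prod_W[of "[i]"] word_prod_W[of "[]"] assms(2) by (simp add: simple_reflection_def)
  moreover obtain x :: "nat \<Rightarrow> 'f" and c where "nonvanishing x" "c \<noteq> 0" "c \<noteq> 1" "c\<^sup>2 \<noteq> 1"
    "\<forall>l\<in>{1..7}. root_value x l = c" by (rule regular_point)
  ultimately have "reflect i x i = x i" "x i \<noteq> 0" "root_value x i = c"
    using words_equal_iff[of "[i]" "[]"] assms(2) by (auto simp: nonvanishing_def simp del: reflect_same)
  then show False using \<open>c \<noteq> 1\<close> \<open>c \<noteq> 0\<close> by (simp add: divide_eq_eq)
qed

lemma T_pow: "t \<in> T \<Longrightarrow> t [^]\<^bsub>GL\<^esub> (n::nat) \<in> T"
  by (induction n) (auto intro: T_one T_mult)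

text \<open>Odd powers of \<open>g\<close> and \<open>h\<close> lie outside \<open>T\<close>, and even powers are powers of the common square \<open>c\<close>.\<close>

lemma element_order_eqI:
  assumes g: "g \<in> N" "g \<notin> T" "g ** g = c" and h: "h \<in> N" "h \<notin> T" "h ** h = c" and c: "c \<in> T"
  shows "element_order g = element_order h"
proof -
  have even_pow: "k [^]\<^bsub>GL\<^esub> (2 * n :: nat) = c [^]\<^bsub>GL\<^esub> n" if "k \<in> N" "k ** k = c" for k n
    using group.is_monoid[OF group_GL] N_invertible[OF that(1)] that(2)
    by (subst monoid.nat_pow_pow[symmetric]) (auto simp: numeral_2_eq_2)
  have odd_pow: "k [^]\<^bsub>GL\<^esub> n \<noteq> mat 1" if k: "k \<in> N" "k \<notin> T" "k ** k = c" and "odd n" for k and n :: nat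
  proof
    assume one: "k [^]\<^bsub>GL\<^esub> n = mat 1"
    from \<open>odd n\<close> obtain m where "n = Suc (2 * m)" by (auto elim: oddE)
    then have "c [^]\<^bsub>GL\<^esub> m ** k = mat 1" using one even_pow[OF k(1,3), of m] by simp
    then have "k = matrix_inv (c [^]\<^bsub>GL\<^esub> m)" by (rule matrix_inv_unique[symmetric])
    then show False using k(2) T_inv[OF T_pow[OF c]] by simp
  qed
  have "g [^]\<^bsub>GL\<^esub> n = \<one>\<^bsub>GL\<^esub> \<longleftrightarrow> h [^]\<^bsub>GL\<^esub> n = \<one>\<^bsub>GL\<^esub>" for n :: nat
    using even_pow[OF g(1,3), of "n div 2"] even_pow[OF h(1,3), of "n div 2"]
      odd_pow[OF g, of n] odd_pow[OF h, of n] by (cases "even n") auto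
  then have "group.ord GL g = group.ord GL h"
    by (simp add: group.ord_def[OF group_GL])
  then show ?thesis by (simp add: element_order_def)
qed

lemma order_profile_unique:
  assumes S: "is_section G T u a S" and S': "is_section G T u a S'" and N0: "is_tits_section G T u a N0"
  shows "order_profile T u a S = order_profile T u a S'"
proof -
  have "element_order (S (srefl i)) = element_order (S' (srefl i))" if i: "i \<in> {1..7}" for i
  proof -
    obtain x x' where "section_parameter T cr u a S x" "section_parameter T cr u a S' x'"
      using section_parameter_exists[OF _ N0] S S' by blast
    then show ?thesis
      using i by (intro element_order_eqI[of _ "cr (a i) (- 1)"] section_in_N[OF S] section_in_N[OF S']
        section_not_in_T[OF S] section_not_in_T[OF S'] section_square coroot_in_T simple_root) auto
  qed
  then show ?thesis by (auto simp: order_profile_def restrict_def)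
qed

section \<open>Conjugacy under the torus\<close>

text \<open>Moving \<open>t\<^sup>-\<^sup>1\<close> past \<open>\<sigma>\<^sub>i\<close> turns it into \<open>s\<^sub>i(t)\<^sup>-\<^sup>1 = t\<^sup>-\<^sup>1 \<alpha>\<^sub>i\<^sup>\<or>(\<alpha>\<^sub>i(t))\<close>, and the
  factor \<open>t\<^sup>-\<^sup>1\<close> cancels against \<open>t\<close>.\<close>

lemma conj_coords:
  assumes z: "nonvanishing z" and y: "nonvanishing y" and i: "i \<in> {1..7}"
  shows "coords z ** (coords y ** \<sigma> i) ** matrix_inv (coords z) =
    coords (y(i := y i * root_value z i)) ** \<sigma> i"
proof -
  let ?z = "\<lambda>k. inverse (z k)"
  have z': "nonvanishing ?z" using z by (simp add: nonvanishing_def)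
  have "coords z ** coords ?z = coords (\<lambda>_. 1)"
    unfolding coords_mult[OF z z'] by (rule coords_cong) (use z in \<open>auto simp: nonvanishing_def\<close>)
  then have "matrix_inv (coords z) = coords ?z"
    by (intro matrix_inv_unique) (simp add: coords_one)
  then have "coords z ** (coords y ** \<sigma> i) ** matrix_inv (coords z) =
      coords z ** coords y ** (\<sigma> i ** coords ?z)"
    by (simp add: matrix_mul_assoc)
  also have "\<dots> = coords z ** coords y ** coords (reflect i ?z) ** \<sigma> i"
    by (simp add: \<sigma>_coords[OF i z'] matrix_mul_assoc)
  also have "coords z ** coords y ** coords (reflect i ?z) =
      coords (\<lambda>k. z k * y k * reflect i ?z k)"
    by (simp add: coords_mult[OF z y] coords_mult[OF nonvanishing_mult[OF z y] nonvanishing_reflect[OF z']])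
  also have "\<dots> = coords (y(i := y i * root_value z i))"
  proof (rule coords_cong)
    fix k :: nat assume "k \<in> {1..7}"
    then have "z k \<noteq> 0" using z by (simp add: nonvanishing_def)
    then show "z k * y k * reflect i ?z k = (y(i := y i * root_value z i)) k"
      by (cases "k = i") (simp_all add: root_value_inverse divide_inverse)
  qed
  finally show ?thesis .
qed

lemma reduced_word_exists:
  assumes "w \<in> carrier W"
  obtains "is" where "reduced_word G T u a is" "w = word_prod W srefl is"
proof -
  let ?P = "\<lambda>is. set is \<subseteq> {1..7} \<and> w = word_prod W srefl is"
  have "\<exists>is. ?P is"
    using setting assms by (auto simp: simply_connected_E7_setting_def weyl_group_of_roots_def)
  then obtain "is" where "?P is" "\<forall>js. ?P js \<longrightarrow> length is \<le> length js"
    using ex_has_least_nat[of ?P _ length] by blast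
  then show ?thesis by (intro that[of "is"]) (auto simp: reduced_word_def)
qed

lemma conj_word_prod:
  assumes t: "invertible t" and "\<And>i. i \<in> {1..7} \<Longrightarrow> conj_by t (g i) = h i" "set is \<subseteq> {1..7}"
  shows "conj_by t (word_prod GL g is) = word_prod GL h is"
  using assms(3)
proof (induction "is")
  case Nil
  then show ?case by (simp add: conj_by_def matrix_inv_inverse[OF t])
next
  case (Cons i "is")
  then show ?case using assms(2)[of i] conj_by_mult[OF t, of "g i", symmetric] by simp
qed

text \<open>For the converse direction, \<open>t\<close> is chosen such that \<open>\<alpha>\<^sub>i(t)\<close> is the quotient of the free coordinates
  at \<open>i\<close>.  Then conjugation by \<open>t\<close> matches the sections on simple reflections, and on every element by
  writing it as a reduced word.\<close>

lemma T_conjugate_iff: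
  assumes S: "is_section G T u a S" and S': "is_section G T u a S'" and N0: "is_tits_section G T u a N0"
  shows "T_conjugate G T S S' \<longleftrightarrow>
    (\<exists>x. section_parameter T cr u a S x \<and> section_parameter T cr u a S' x)"
proof
  assume "T_conjugate G T S S'"
  then obtain t where t: "t \<in> T" "\<forall>w\<in>carrier W. t ** S w ** matrix_inv t = S' w"
    by (auto simp: T_conjugate_def)
  obtain z where z: "nonvanishing z" "t = coords z" by (rule coords_surj[OF t(1)])
  obtain x where x: "section_parameter T cr u a S x" using section_parameter_exists[OF S N0] by blast
  then have x2: "x\<^sup>2 = 1" by (simp add: section_parameter_def)
  have "\<exists>y. y \<noteq> 0 \<and> S' (srefl i) = coords (parameter_coords x i y) ** \<sigma> i" if i: "i \<in> {1..7}" for i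
  proof -
    obtain y where y: "y \<noteq> 0" "S (srefl i) = coords (parameter_coords x i y) ** \<sigma> i"
      using x i unfolding section_parameter_iff by blast
    have "S' (srefl i) = coords ((parameter_coords x i y)(i := parameter_coords x i y i * root_value z i)) ** \<sigma> i"
      using bspec[OF t(2) srefl_in_W[OF i]] unfolding y(2) z(2)
        conj_coords[OF z(1) nonvanishing_parameter_coords[OF x2 y(1)] i] by simp
    then have "S' (srefl i) = coords (parameter_coords x i (y * root_value z i)) ** \<sigma> i"
      by (simp add: parameter_coords_def)
    then show ?thesis
      using y(1) root_value_nonzero[OF z(1), of i]
      by (intro exI[of _ "y * root_value z i"]) simp
  qed
  then have "section_parameter T cr u a S' x"
    unfolding section_parameter_iff using x2 by blast
  then show "\<exists>x. section_parameter T cr u a S x \<and> section_parameter T cr u a S' x" using x by blast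
next
  assume "\<exists>x. section_parameter T cr u a S x \<and> section_parameter T cr u a S' x"
  then obtain x where x: "x\<^sup>2 = 1" and
    par: "\<forall>i\<in>{1..7}. \<exists>y. y \<noteq> 0 \<and> S (srefl i) = coords (parameter_coords x i y) ** \<sigma> i" and
    par': "\<forall>i\<in>{1..7}. \<exists>y. y \<noteq> 0 \<and> S' (srefl i) = coords (parameter_coords x i y) ** \<sigma> i"
    unfolding section_parameter_iff by blast
  obtain y where y: "\<forall>i\<in>{1..7}. y i \<noteq> 0 \<and> S (srefl i) = coords (parameter_coords x i (y i)) ** \<sigma> i"
    using bchoice[OF par] by blast
  obtain y' where y': "\<forall>i\<in>{1..7}. y' i \<noteq> 0 \<and> S' (srefl i) = coords (parameter_coords x i (y' i)) ** \<sigma> i"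
    using bchoice[OF par'] by blast
  obtain z where z: "nonvanishing z" "\<forall>l\<in>{1..7}. root_value z l = y' l / y l"
    using root_value_surj[of "\<lambda>l. y' l / y l"] y y' by (auto simp: nonvanishing_def)
  define t where "t = coords z"
  have t: "t \<in> T" unfolding t_def by (rule coords_in_T[OF z(1)])
  have simple: "conj_by t (S (srefl i)) = S' (srefl i)" if i: "i \<in> {1..7}" for i
  proof -
    have yi: "y i \<noteq> 0" using y i by blast
    have "conj_by t (S (srefl i)) =
        coords ((parameter_coords x i (y i))(i := parameter_coords x i (y i) i * root_value z i)) ** \<sigma> i"
      using y i conj_coords[OF z(1) nonvanishing_parameter_coords[OF x yi] i]
      by (simp add: conj_by_def t_def)
    also have "\<dots> = coords (parameter_coords x i (y' i)) ** \<sigma> i"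
      using z(2) i yi by (simp add: parameter_coords_def)
    finally show ?thesis using y' i by simp
  qed
  have "t ** S w ** matrix_inv t = S' w" if w: "w \<in> carrier W" for w
  proof -
    obtain "is" where "is": "reduced_word G T u a is" "w = word_prod W srefl is"
      by (rule reduced_word_exists[OF w])
    have "set is \<subseteq> {1..7}" using "is"(1) by (simp add: reduced_word_def)
    from conj_word_prod[OF T_invertible[OF t] simple this] show ?thesis
      by (simp add: "is"(2) section_word[OF S "is"(1)] section_word[OF S' "is"(1)] conj_by_def)
  qed
  then show "T_conjugate G T S S'" using t by (auto simp: T_conjugate_def)
qed

end

section \<open>Sections in simply connected groups of type $E_7$\<close>

theorem proposition3p19:
  fixes G T :: "('f::alg_closed_field ^ 'n ^ 'n) set"
    and cr u :: "('f ^ 'n ^ 'n \<Rightarrow> 'f) \<Rightarrow> 'f \<Rightarrow> 'f ^ 'n ^ 'n"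
    and a :: "nat \<Rightarrow> 'f ^ 'n ^ 'n \<Rightarrow> 'f"
    and N0 :: "('f ^ 'n ^ 'n) set \<Rightarrow> 'f ^ 'n ^ 'n"
  assumes "simply_connected_E7_setting G T cr u a"
    and "is_tits_section G T u a N0"
  shows "(optimal_section G T u a N0 \<and>
          ((2::'f) \<noteq> 0 \<longrightarrow> (\<forall>i\<in>{1..7}.
             N0 (simple_reflection T u a i) ** N0 (simple_reflection T u a i) \<noteq> mat 1)) \<and>
          (\<forall>S S'. is_section G T u a S \<and> is_section G T u a S' \<longrightarrow>
             order_profile T u a S = order_profile T u a S')) \<and>
         (\<forall>S S'. is_section G T u a S \<and> is_section G T u a S' \<longrightarrow>
             (T_conjugate G T S S' \<longleftrightarrow>
              (\<exists>x. section_parameter T cr u a S x \<and> section_parameter T cr u a S' x)))"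
proof -
  interpret e7_group G T cr u a by unfold_locales (rule assms(1))
  note N0 = assms(2)
  have section_N0: "is_section G T u a N0" using N0 by (simp add: is_tits_section_def)
  have profile: "order_profile T u a S = order_profile T u a N0" if "is_section G T u a S" for S
    by (rule order_profile_unique[OF that section_N0 N0])
  have "\<not> profile_less p p" for p
  proof -
    have "(1::nat) \<in> {1..7}" by simp
    then show ?thesis unfolding profile_less_def by blast
  qed
  then have "\<not> profile_less (order_profile T u a N0) (order_profile T u a S)"
    if "is_section G T u a S" for S using profile[OF that] by metis
  then have "maximal_profile G T u a (order_profile T u a N0)"
    unfolding maximal_profile_def using section_N0 by blast
  moreover have "p = order_profile T u a N0" if max: "maximal_profile G T u a p" for p
  proof -
    obtain S where "is_section G T u a S" "p = order_profile T u a S"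
      using max unfolding maximal_profile_def by blast
    then show ?thesis using profile by metis
  qed
  ultimately have "optimal_section G T u a N0"
    unfolding optimal_section_def using section_N0 by blast
  moreover have "N0 (srefl i) ** N0 (srefl i) \<noteq> mat 1" if "(2::'f) \<noteq> 0" "i \<in> {1..7}" for i
    using N0 that coroot_minus_one tits_element_square[OF simple_root] by (simp add: is_tits_section_def)
  moreover have "order_profile T u a S = order_profile T u a S'"
    if "is_section G T u a S" "is_section G T u a S'" for S S'
    by (rule order_profile_unique[OF that N0])
  moreover have "T_conjugate G T S S' \<longleftrightarrow>
      (\<exists>x. section_parameter T cr u a S x \<and> section_parameter T cr u a S' x)"
    if "is_section G T u a S" "is_section G T u a S'" for S S'
    by (rule T_conjugate_iff[OF that N0])
  ultimately show ?thesis by blast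
qed

end
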